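(* The syntactic category with families $\mathcal T$ is a free cwf on one object (base type): for every cwf $\mathcal C$ and every $o_{\mathcal C}\in\mathrm{Ty}_{\mathcal C}(1_{\mathcal C})$ there is a unique strict cwf-morphism $\mathcal T\to\mathcal C$ which maps $[o]$ to $o_{\mathcal C}$.
   Context: **Cwf.** A category with families (cwf) $\mathcal C$ consists of: a category with set of objects $\mathrm{Ctx}_{\mathcal C}$ (contexts) and hom-sets $\mathrm{Sub}_{\mathcal C}(\Gamma,\Delta)$ (substitutions); for each context $\Gamma$ a set $\mathrm{Ty}_{\mathcal C}(\Gamma)$ of types and for each $A\in\mathrm{Ty}_{\mathcal C}(\Gamma)$ a set $\mathrm{Tm}_{\mathcal C}(\Gamma,A)$ of terms; for $\gamma\in\mathrm{Sub}_{\mathcal C}(\Gamma,\Delta)$ maps $A\mapsto A[\gamma]$, $\mathrm{Ty}(\Delta)\to\mathrm{Ty}(\Gamma)$, and $a\mapsto a[\gamma]$, $\mathrm{Tm}(\Delta,A)\to\mathrm{Tm}(\Gamma,A[\gamma])$, functorial in $\gamma$ ($A[\mathrm{id}]=A$, $A[\gamma\circ\delta]=A[\gamma][\delta]$, same for terms); a chosen terminal object $1$; for each $\Delta$ and $A\in\mathrm{Ty}(\Delta)$ a chosen context $\Delta.A$ with $\mathrm p_A\in\mathrm{Sub}(\Delta.A,\Delta)$ and $\mathrm q_A\in\mathrm{Tm}(\Delta.A,A[\mathrm p_A])$ such that for all $\gamma\in\mathrm{Sub}(\Gamma,\Delta)$, $a\in\mathrm{Tm}(\Gamma,A[\gamma])$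 there is a unique $\langle\gamma,a\rangle\in\mathrm{Sub}(\Gamma,\Delta.A)$ with $\mathrm p_A\circ\langle\gamma,a\rangle=\gamma$ and $\mathrm q_A[\langle\gamma,a\rangle]=a$. **Strict cwf-morphism** $F:\mathcal C\to\mathcal D$: a functor together with maps $\mathrm{Ty}_{\mathcal C}(\Gamma)\to\mathrm{Ty}_{\mathcal D}(F\Gamma)$ and $\mathrm{Tm}_{\mathcal C}(\Gamma,A)\to\mathrm{Tm}_{\mathcal D}(F\Gamma,FA)$ preserving all cwf-structure on the nose (substitution in types and terms, $1$, $\Gamma.A$, $\mathrm p$, $\mathrm q$, hence $\langle\gamma,a\rangle$). **Raw syntax** (contexts, substitutions, types, terms): $\Gamma::=1\mid\Gamma.A$; $\gamma::=\gamma\circ\gamma\mid\mathrm{id}_\Gamma\mid\langle\rangle_\Gamma\mid\mathrm p_A\mid\langle\gamma,a\rangle_A$; $A::=o\mid A[\gamma]$; $a::=a[\gamma]\mid\mathrm q_A$. **Judgments**, defined simultaneously inductively: $\Gamma=\Gamma'\vdash$, $\Delta\vdash\gamma=\gamma':\Gamma$, $\Gamma\vdash A=A'$, $\Gamma\vdash a=a':A$. Reflexive instances are abbreviated $\Gamma\vdash$, $\Delta\vdash\gamma:\Gamma$, $\Gamma\vdash A$, $\Gamma\vdash a:A$. *Per rules*: each of the four relations is symmetric and transitive. *Preservation*: if $\Gamma=\Gamma'\vdash$, $\Delta=\Delta'\vdash$, $\Gamma\vdash\gamma=\gamma':\Delta$ then $\Gamma'\vdash\gamma=\gamma':\Delta'$;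 if $\Gamma=\Gamma'\vdash$, $\Gamma\vdash A=A'$ then $\Gamma'\vdash A=A'$; if $\Gamma=\Gamma'\vdash$, $\Gamma\vdash A=A'$, $\Gamma\vdash a=a':A$ then $\Gamma'\vdash a=a':A'$. *Congruence*: $1=1\vdash$; $1\vdash o=o$; if $\Gamma=\Gamma'\vdash$ and $\Gamma\vdash A=A'$ then $\Gamma.A=\Gamma'.A'\vdash$; if $\Gamma\vdash A=A'$ and $\Delta\vdash\gamma=\gamma':\Gamma$ then $\Delta\vdash A[\gamma]=A'[\gamma']$; if $\Gamma=\Gamma'\vdash$ then $\Gamma\vdash\mathrm{id}_\Gamma=\mathrm{id}_{\Gamma'}:\Gamma$ and $\Gamma\vdash\langle\rangle_\Gamma=\langle\rangle_{\Gamma'}:1$; if $\Gamma\vdash\delta=\delta':\Delta$ and $\Delta\vdash\gamma=\gamma':\Theta$ then $\Gamma\vdash\gamma\circ\delta=\gamma'\circ\delta':\Theta$; if $\Gamma\vdash A=A'$ then $\Gamma.A\vdash\mathrm p_A=\mathrm p_{A'}:\Gamma$ and $\Gamma.A\vdash\mathrm q_A=\mathrm q_{A'}:A[\mathrm p_A]$; if $\Gamma\vdash A=A'$, $\Delta\vdash\gamma=\gamma':\Gamma$, $\Delta\vdash a=a':A[\gamma]$ then $\Delta\vdash\langle\gamma,a\rangle_A=\langle\gamma',a'\rangle_{A'}:\Gamma.A$; if $\Gamma\vdash a=a':A$, $\Delta\vdash\gamma=\gamma':\Gamma$ then $\Delta\vdash a[\gamma]=a'[\gamma']:A[\gamma]$.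 *Conversion* (whenever the constituents are well-typed): $(\theta\circ\delta)\circ\gamma=\theta\circ(\delta\circ\gamma)$; $\gamma=\mathrm{id}\circ\gamma$; $\gamma=\gamma\circ\mathrm{id}$; $A[\gamma\circ\delta]=A[\gamma][\delta]$; $A[\mathrm{id}]=A$; $a[\gamma\circ\delta]=a[\gamma][\delta]$; $a[\mathrm{id}]=a$; $\gamma=\langle\rangle_\Gamma$ if $\Gamma\vdash\gamma:1$; $\mathrm p_A\circ\langle\gamma,a\rangle_A=\gamma$; $\mathrm q_A[\langle\gamma,a\rangle_A]=a$; $\gamma=\langle\mathrm p_A\circ\gamma,\mathrm q_A[\gamma]\rangle_A$ if $\Delta\vdash\gamma:\Gamma.A$. **The cwf $\mathcal T$**: $\mathrm{Ctx}_{\mathcal T}$ is the set of $\Gamma$ with $\Gamma\vdash$ modulo derivable equality; $\mathrm{Sub}_{\mathcal T}([\Gamma],[\Delta])$ is the set of $\gamma$ with $\Gamma\vdash\gamma:\Delta$ modulo derivable equality; $\mathrm{Ty}_{\mathcal T}([\Gamma])$ is the set of $A$ with $\Gamma\vdash A$ modulo derivable equality; $\mathrm{Tm}_{\mathcal T}([\Gamma],[A])$ is the set of $a$ with $\Gamma\vdash a:A$ modulo derivable equality; cwf-operations are induced by the syntactic constructors. $[-]$ denotes equivalence classes. *)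

theory Defs
  imports "HOL-Library.FuncSet"
begin

section \<open>Categories with families\<close>

text \<open>
  The hom-sets, and likewise the sets of types and of terms, are not assumed to be disjoint for
  different indices.  Every operation therefore carries the indices of its arguments:
  \<open>Comp C \<Gamma> \<Delta> \<Theta> \<gamma> \<delta>\<close> is \<open>\<gamma> \<circ> \<delta>\<close> for \<open>\<delta> \<in> Sub C \<Gamma> \<Delta>\<close> and \<open>\<gamma> \<in> Sub C \<Delta> \<Theta>\<close>;
  \<open>TySub C \<Gamma> \<Delta> A \<gamma>\<close> is \<open>A[\<gamma>]\<close> and \<open>TmSub C \<Gamma> \<Delta> A a \<gamma>\<close> is \<open>a[\<gamma>]\<close> for
  \<open>\<gamma> \<in> Sub C \<Gamma> \<Delta>\<close>, \<open>A \<in> Ty C \<Delta>\<close>, \<open>a \<in> Tm C \<Delta> A\<close>.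
  The values of the operations outside the indicated sets are irrelevant.
\<close>

record ('c, 's, 't, 'm) cwf_data =
  Ctx :: "'c set"
  Sub :: "'c \<Rightarrow> 'c \<Rightarrow> 's set"
  Id :: "'c \<Rightarrow> 's"
  Comp :: "'c \<Rightarrow> 'c \<Rightarrow> 'c \<Rightarrow> 's \<Rightarrow> 's \<Rightarrow> 's"
  Ty :: "'c \<Rightarrow> 't set"
  Tm :: "'c \<Rightarrow> 't \<Rightarrow> 'm set"
  TySub :: "'c \<Rightarrow> 'c \<Rightarrow> 't \<Rightarrow> 's \<Rightarrow> 't"
  TmSub :: "'c \<Rightarrow> 'c \<Rightarrow> 't \<Rightarrow> 'm \<Rightarrow> 's \<Rightarrow> 'm"
  One :: "'c"
  Ext :: "'c \<Rightarrow> 't \<Rightarrow> 'c"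
  P :: "'c \<Rightarrow> 't \<Rightarrow> 's"
  Q :: "'c \<Rightarrow> 't \<Rightarrow> 'm"

locale cwf =
  fixes C :: "('c, 's, 't, 'm) cwf_data"
  assumes Id_closed: "\<Gamma> \<in> Ctx C \<Longrightarrow> Id C \<Gamma> \<in> Sub C \<Gamma> \<Gamma>"
    and Comp_closed:
      "\<lbrakk>\<Gamma> \<in> Ctx C; \<Delta> \<in> Ctx C; \<Theta> \<in> Ctx C; \<delta> \<in> Sub C \<Gamma> \<Delta>; \<gamma> \<in> Sub C \<Delta> \<Theta>\<rbrakk>
        \<Longrightarrow> Comp C \<Gamma> \<Delta> \<Theta> \<gamma> \<delta> \<in> Sub C \<Gamma> \<Theta>"
    and Comp_assoc:
      "\<lbrakk>\<Gamma> \<in> Ctx C; \<Delta> \<in> Ctx C; \<Theta> \<in> Ctx C; \<Xi> \<in> Ctx C;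
        \<gamma> \<in> Sub C \<Gamma> \<Delta>; \<delta> \<in> Sub C \<Delta> \<Theta>; \<theta> \<in> Sub C \<Theta> \<Xi>\<rbrakk>
        \<Longrightarrow> Comp C \<Gamma> \<Delta> \<Xi> (Comp C \<Delta> \<Theta> \<Xi> \<theta> \<delta>) \<gamma> = Comp C \<Gamma> \<Theta> \<Xi> \<theta> (Comp C \<Gamma> \<Delta> \<Theta> \<delta> \<gamma>)"
    and Id_Comp:
      "\<lbrakk>\<Gamma> \<in> Ctx C; \<Delta> \<in> Ctx C; \<gamma> \<in> Sub C \<Gamma> \<Delta>\<rbrakk> \<Longrightarrow> Comp C \<Gamma> \<Delta> \<Delta> (Id C \<Delta>) \<gamma> = \<gamma>"
    and Comp_Id:
      "\<lbrakk>\<Gamma> \<in> Ctx C; \<Delta> \<in> Ctx C; \<gamma> \<in> Sub C \<Gamma> \<Delta>\<rbrakk> \<Longrightarrow> Comp C \<Gamma> \<Gamma> \<Delta> \<gamma> (Id C \<Gamma>) = \<gamma>"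
    and TySub_closed:
      "\<lbrakk>\<Gamma> \<in> Ctx C; \<Delta> \<in> Ctx C; \<gamma> \<in> Sub C \<Gamma> \<Delta>; A \<in> Ty C \<Delta>\<rbrakk>
        \<Longrightarrow> TySub C \<Gamma> \<Delta> A \<gamma> \<in> Ty C \<Gamma>"
    and TySub_Id: "\<lbrakk>\<Gamma> \<in> Ctx C; A \<in> Ty C \<Gamma>\<rbrakk> \<Longrightarrow> TySub C \<Gamma> \<Gamma> A (Id C \<Gamma>) = A"
    and TySub_Comp:
      "\<lbrakk>\<Gamma> \<in> Ctx C; \<Delta> \<in> Ctx C; \<Theta> \<in> Ctx C; \<delta> \<in> Sub C \<Gamma> \<Delta>; \<gamma> \<in> Sub C \<Delta> \<Theta>; A \<in> Ty C \<Theta>\<rbrakk>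
        \<Longrightarrow> TySub C \<Gamma> \<Theta> A (Comp C \<Gamma> \<Delta> \<Theta> \<gamma> \<delta>) = TySub C \<Gamma> \<Delta> (TySub C \<Delta> \<Theta> A \<gamma>) \<delta>"
    and TmSub_closed:
      "\<lbrakk>\<Gamma> \<in> Ctx C; \<Delta> \<in> Ctx C; \<gamma> \<in> Sub C \<Gamma> \<Delta>; A \<in> Ty C \<Delta>; a \<in> Tm C \<Delta> A\<rbrakk>
        \<Longrightarrow> TmSub C \<Gamma> \<Delta> A a \<gamma> \<in> Tm C \<Gamma> (TySub C \<Gamma> \<Delta> A \<gamma>)"
    and TmSub_Id:
      "\<lbrakk>\<Gamma> \<in> Ctx C; A \<in> Ty C \<Gamma>; a \<in> Tm C \<Gamma> A\<rbrakk> \<Longrightarrow> TmSub C \<Gamma> \<Gamma> A a (Id C \<Gamma>) = a"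
    and TmSub_Comp:
      "\<lbrakk>\<Gamma> \<in> Ctx C; \<Delta> \<in> Ctx C; \<Theta> \<in> Ctx C; \<delta> \<in> Sub C \<Gamma> \<Delta>; \<gamma> \<in> Sub C \<Delta> \<Theta>;
        A \<in> Ty C \<Theta>; a \<in> Tm C \<Theta> A\<rbrakk>
        \<Longrightarrow> TmSub C \<Gamma> \<Theta> A a (Comp C \<Gamma> \<Delta> \<Theta> \<gamma> \<delta>)
          = TmSub C \<Gamma> \<Delta> (TySub C \<Delta> \<Theta> A \<gamma>) (TmSub C \<Delta> \<Theta> A a \<gamma>) \<delta>"
    and One_closed: "One C \<in> Ctx C"
    and One_terminal: "\<Gamma> \<in> Ctx C \<Longrightarrow> \<exists>!\<gamma>. \<gamma> \<in> Sub C \<Gamma> (One C)"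
    and Ext_closed: "\<lbrakk>\<Delta> \<in> Ctx C; A \<in> Ty C \<Delta>\<rbrakk> \<Longrightarrow> Ext C \<Delta> A \<in> Ctx C"
    and P_closed: "\<lbrakk>\<Delta> \<in> Ctx C; A \<in> Ty C \<Delta>\<rbrakk> \<Longrightarrow> P C \<Delta> A \<in> Sub C (Ext C \<Delta> A) \<Delta>"
    and Q_closed:
      "\<lbrakk>\<Delta> \<in> Ctx C; A \<in> Ty C \<Delta>\<rbrakk>
        \<Longrightarrow> Q C \<Delta> A \<in> Tm C (Ext C \<Delta> A) (TySub C (Ext C \<Delta> A) \<Delta> A (P C \<Delta> A))"
    and Ext_universal:
      "\<lbrakk>\<Gamma> \<in> Ctx C; \<Delta> \<in> Ctx C; A \<in> Ty C \<Delta>; \<gamma> \<in> Sub C \<Gamma> \<Delta>; a \<in> Tm C \<Gamma> (TySub C \<Gamma> \<Delta> A \<gamma>)\<rbrakk>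
        \<Longrightarrow> \<exists>!\<theta>. \<theta> \<in> Sub C \<Gamma> (Ext C \<Delta> A)
              \<and> Comp C \<Gamma> (Ext C \<Delta> A) \<Delta> (P C \<Delta> A) \<theta> = \<gamma>
              \<and> TmSub C \<Gamma> (Ext C \<Delta> A) (TySub C (Ext C \<Delta> A) \<Delta> A (P C \<Delta> A)) (Q C \<Delta> A) \<theta> = a"


section \<open>Strict cwf-morphisms\<close>

text \<open>
  The components are extensional dependent functions (they take the value
  \<^const>\<open>undefined\<close> outside the carriers of the source), so that two morphisms are equal as
  records iff they agree on all contexts, substitutions, types and terms of the source.
\<close>

record ('c, 's, 't, 'm, 'c1, 's1, 't1, 'm1) cwf_maps =
  FCtx :: "'c \<Rightarrow> 'c1"
  FSub :: "'c \<Rightarrow> 'c \<Rightarrow> 's \<Rightarrow> 's1"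
  FTy :: "'c \<Rightarrow> 't \<Rightarrow> 't1"
  FTm :: "'c \<Rightarrow> 't \<Rightarrow> 'm \<Rightarrow> 'm1"

locale strict_cwf_morphism = C: cwf C + D: cwf D
  for C :: "('c, 's, 't, 'm) cwf_data" and D :: "('c1, 's1, 't1, 'm1) cwf_data" +
  fixes F :: "('c, 's, 't, 'm, 'c1, 's1, 't1, 'm1) cwf_maps"
  assumes FCtx_fun: "FCtx F \<in> Ctx C \<rightarrow>\<^sub>E Ctx D"
    and FSub_fun:
      "FSub F \<in> (\<Pi>\<^sub>E \<Gamma>\<in>Ctx C. \<Pi>\<^sub>E \<Delta>\<in>Ctx C. Sub C \<Gamma> \<Delta> \<rightarrow>\<^sub>E Sub D (FCtx F \<Gamma>) (FCtx F \<Delta>))"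
    and FTy_fun: "FTy F \<in> (\<Pi>\<^sub>E \<Gamma>\<in>Ctx C. Ty C \<Gamma> \<rightarrow>\<^sub>E Ty D (FCtx F \<Gamma>))"
    and FTm_fun:
      "FTm F \<in> (\<Pi>\<^sub>E \<Gamma>\<in>Ctx C. \<Pi>\<^sub>E A\<in>Ty C \<Gamma>. Tm C \<Gamma> A \<rightarrow>\<^sub>E Tm D (FCtx F \<Gamma>) (FTy F \<Gamma> A))"
    and F_Id: "\<Gamma> \<in> Ctx C \<Longrightarrow> FSub F \<Gamma> \<Gamma> (Id C \<Gamma>) = Id D (FCtx F \<Gamma>)"
    and F_Comp:
      "\<lbrakk>\<Gamma> \<in> Ctx C; \<Delta> \<in> Ctx C; \<Theta> \<in> Ctx C; \<delta> \<in> Sub C \<Gamma> \<Delta>; \<gamma> \<in> Sub C \<Delta> \<Theta>\<rbrakk>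
        \<Longrightarrow> FSub F \<Gamma> \<Theta> (Comp C \<Gamma> \<Delta> \<Theta> \<gamma> \<delta>)
          = Comp D (FCtx F \<Gamma>) (FCtx F \<Delta>) (FCtx F \<Theta>) (FSub F \<Delta> \<Theta> \<gamma>) (FSub F \<Gamma> \<Delta> \<delta>)"
    and F_TySub:
      "\<lbrakk>\<Gamma> \<in> Ctx C; \<Delta> \<in> Ctx C; \<gamma> \<in> Sub C \<Gamma> \<Delta>; A \<in> Ty C \<Delta>\<rbrakk>
        \<Longrightarrow> FTy F \<Gamma> (TySub C \<Gamma> \<Delta> A \<gamma>)
          = TySub D (FCtx F \<Gamma>) (FCtx F \<Delta>) (FTy F \<Delta> A) (FSub F \<Gamma> \<Delta> \<gamma>)"
    and F_TmSub:
      "\<lbrakk>\<Gamma> \<in> Ctx C; \<Delta> \<in> Ctx C; \<gamma> \<in> Sub C \<Gamma> \<Delta>; A \<in> Ty C \<Delta>; a \<in> Tm C \<Delta> A\<rbrakk>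
        \<Longrightarrow> FTm F \<Gamma> (TySub C \<Gamma> \<Delta> A \<gamma>) (TmSub C \<Gamma> \<Delta> A a \<gamma>)
          = TmSub D (FCtx F \<Gamma>) (FCtx F \<Delta>) (FTy F \<Delta> A) (FTm F \<Delta> A a) (FSub F \<Gamma> \<Delta> \<gamma>)"
    and F_One: "FCtx F (One C) = One D"
    and F_Ext:
      "\<lbrakk>\<Delta> \<in> Ctx C; A \<in> Ty C \<Delta>\<rbrakk> \<Longrightarrow> FCtx F (Ext C \<Delta> A) = Ext D (FCtx F \<Delta>) (FTy F \<Delta> A)"
    and F_P:
      "\<lbrakk>\<Delta> \<in> Ctx C; A \<in> Ty C \<Delta>\<rbrakk>
        \<Longrightarrow> FSub F (Ext C \<Delta> A) \<Delta> (P C \<Delta> A) = P D (FCtx F \<Delta>) (FTy F \<Delta> A)"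
    and F_Q:
      "\<lbrakk>\<Delta> \<in> Ctx C; A \<in> Ty C \<Delta>\<rbrakk>
        \<Longrightarrow> FTm F (Ext C \<Delta> A) (TySub C (Ext C \<Delta> A) \<Delta> A (P C \<Delta> A)) (Q C \<Delta> A)
          = Q D (FCtx F \<Delta>) (FTy F \<Delta> A)"


section \<open>Raw syntax and judgments\<close>

datatype raw_ctx =
    rOne
  | rExt raw_ctx raw_ty
and raw_sub =
    rComp raw_sub raw_sub
  | rId raw_ctx
  | rBang raw_ctx  \<comment> \<open>\<open>\<langle>\<rangle>\<^sub>\<Gamma>\<close>\<close>
  | rP raw_ty
  | rPair raw_ty raw_sub raw_tm  \<comment> \<open>\<open>rPair A \<gamma> a\<close> is \<open>\<langle>\<gamma>, a\<rangle>\<^sub>A\<close>\<close>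
and raw_ty =
    rBase
  | rTySub raw_ty raw_sub
and raw_tm =
    rTmSub raw_tm raw_sub
  | rQ raw_ty

text \<open>
  \<open>eq_ctx \<Gamma> \<Gamma>'\<close> is \<open>\<Gamma> = \<Gamma>' \<turnstile>\<close>, \<open>eq_sub \<Delta> \<gamma> \<gamma>' \<Gamma>\<close> is \<open>\<Delta> \<turnstile> \<gamma> = \<gamma>' : \<Gamma>\<close>,
  \<open>eq_ty \<Gamma> A A'\<close> is \<open>\<Gamma> \<turnstile> A = A'\<close>, and \<open>eq_tm \<Gamma> a a' A\<close> is \<open>\<Gamma> \<turnstile> a = a' : A\<close>.
  Well-formedness judgments are the reflexive instances.
\<close>

inductive
      eq_ctx :: "raw_ctx \<Rightarrow> raw_ctx \<Rightarrow> bool"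
  and eq_sub :: "raw_ctx \<Rightarrow> raw_sub \<Rightarrow> raw_sub \<Rightarrow> raw_ctx \<Rightarrow> bool"
  and eq_ty :: "raw_ctx \<Rightarrow> raw_ty \<Rightarrow> raw_ty \<Rightarrow> bool"
  and eq_tm :: "raw_ctx \<Rightarrow> raw_tm \<Rightarrow> raw_tm \<Rightarrow> raw_ty \<Rightarrow> bool"
where
  ctx_sym: "eq_ctx \<Gamma> \<Gamma>' \<Longrightarrow> eq_ctx \<Gamma>' \<Gamma>"
| ctx_trans: "\<lbrakk>eq_ctx \<Gamma> \<Gamma>'; eq_ctx \<Gamma>' \<Gamma>''\<rbrakk> \<Longrightarrow> eq_ctx \<Gamma> \<Gamma>''"
| sub_sym: "eq_sub \<Delta> \<gamma> \<gamma>' \<Gamma> \<Longrightarrow> eq_sub \<Delta> \<gamma>' \<gamma> \<Gamma>"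
| sub_trans: "\<lbrakk>eq_sub \<Delta> \<gamma> \<gamma>' \<Gamma>; eq_sub \<Delta> \<gamma>' \<gamma>'' \<Gamma>\<rbrakk> \<Longrightarrow> eq_sub \<Delta> \<gamma> \<gamma>'' \<Gamma>"
| ty_sym: "eq_ty \<Gamma> A A' \<Longrightarrow> eq_ty \<Gamma> A' A"
| ty_trans: "\<lbrakk>eq_ty \<Gamma> A A'; eq_ty \<Gamma> A' A''\<rbrakk> \<Longrightarrow> eq_ty \<Gamma> A A''"
| tm_sym: "eq_tm \<Gamma> a a' A \<Longrightarrow> eq_tm \<Gamma> a' a A"
| tm_trans: "\<lbrakk>eq_tm \<Gamma> a a' A; eq_tm \<Gamma> a' a'' A\<rbrakk> \<Longrightarrow> eq_tm \<Gamma> a a'' A"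
| sub_pres: "\<lbrakk>eq_ctx \<Gamma> \<Gamma>'; eq_ctx \<Delta> \<Delta>'; eq_sub \<Gamma> \<gamma> \<gamma>' \<Delta>\<rbrakk> \<Longrightarrow> eq_sub \<Gamma>' \<gamma> \<gamma>' \<Delta>'"
| ty_pres: "\<lbrakk>eq_ctx \<Gamma> \<Gamma>'; eq_ty \<Gamma> A A'\<rbrakk> \<Longrightarrow> eq_ty \<Gamma>' A A'"
| tm_pres: "\<lbrakk>eq_ctx \<Gamma> \<Gamma>'; eq_ty \<Gamma> A A'; eq_tm \<Gamma> a a' A\<rbrakk> \<Longrightarrow> eq_tm \<Gamma>' a a' A'"
| cong_One: "eq_ctx rOne rOne"
| cong_Base: "eq_ty rOne rBase rBase"
| cong_Ext: "\<lbrakk>eq_ctx \<Gamma> \<Gamma>'; eq_ty \<Gamma> A A'\<rbrakk> \<Longrightarrow> eq_ctx (rExt \<Gamma> A) (rExt \<Gamma>' A')"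
| cong_TySub:
    "\<lbrakk>eq_ty \<Gamma> A A'; eq_sub \<Delta> \<gamma> \<gamma>' \<Gamma>\<rbrakk> \<Longrightarrow> eq_ty \<Delta> (rTySub A \<gamma>) (rTySub A' \<gamma>')"
| cong_Id: "eq_ctx \<Gamma> \<Gamma>' \<Longrightarrow> eq_sub \<Gamma> (rId \<Gamma>) (rId \<Gamma>') \<Gamma>"
| cong_Bang: "eq_ctx \<Gamma> \<Gamma>' \<Longrightarrow> eq_sub \<Gamma> (rBang \<Gamma>) (rBang \<Gamma>') rOne"
| cong_Comp:
    "\<lbrakk>eq_sub \<Gamma> \<delta> \<delta>' \<Delta>; eq_sub \<Delta> \<gamma> \<gamma>' \<Theta>\<rbrakk> \<Longrightarrow> eq_sub \<Gamma> (rComp \<gamma> \<delta>) (rComp \<gamma>' \<delta>') \<Theta>"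
| cong_P: "eq_ty \<Gamma> A A' \<Longrightarrow> eq_sub (rExt \<Gamma> A) (rP A) (rP A') \<Gamma>"
| cong_Q: "eq_ty \<Gamma> A A' \<Longrightarrow> eq_tm (rExt \<Gamma> A) (rQ A) (rQ A') (rTySub A (rP A))"
| cong_Pair:
    "\<lbrakk>eq_ty \<Gamma> A A'; eq_sub \<Delta> \<gamma> \<gamma>' \<Gamma>; eq_tm \<Delta> a a' (rTySub A \<gamma>)\<rbrakk>
      \<Longrightarrow> eq_sub \<Delta> (rPair A \<gamma> a) (rPair A' \<gamma>' a') (rExt \<Gamma> A)"
| cong_TmSub:
    "\<lbrakk>eq_tm \<Gamma> a a' A; eq_sub \<Delta> \<gamma> \<gamma>' \<Gamma>\<rbrakk>
      \<Longrightarrow> eq_tm \<Delta> (rTmSub a \<gamma>) (rTmSub a' \<gamma>') (rTySub A \<gamma>)"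
| conv_assoc:
    "\<lbrakk>eq_sub \<Gamma> \<gamma> \<gamma> \<Delta>; eq_sub \<Delta> \<delta> \<delta> \<Theta>; eq_sub \<Theta> \<theta> \<theta> \<Xi>\<rbrakk>
      \<Longrightarrow> eq_sub \<Gamma> (rComp (rComp \<theta> \<delta>) \<gamma>) (rComp \<theta> (rComp \<delta> \<gamma>)) \<Xi>"
| conv_Id_Comp: "eq_sub \<Gamma> \<gamma> \<gamma> \<Delta> \<Longrightarrow> eq_sub \<Gamma> \<gamma> (rComp (rId \<Delta>) \<gamma>) \<Delta>"
| conv_Comp_Id: "eq_sub \<Gamma> \<gamma> \<gamma> \<Delta> \<Longrightarrow> eq_sub \<Gamma> \<gamma> (rComp \<gamma> (rId \<Gamma>)) \<Delta>"
| conv_TySub_Comp: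
    "\<lbrakk>eq_ty \<Theta> A A; eq_sub \<Delta> \<gamma> \<gamma> \<Theta>; eq_sub \<Gamma> \<delta> \<delta> \<Delta>\<rbrakk>
      \<Longrightarrow> eq_ty \<Gamma> (rTySub A (rComp \<gamma> \<delta>)) (rTySub (rTySub A \<gamma>) \<delta>)"
| conv_TySub_Id: "eq_ty \<Gamma> A A \<Longrightarrow> eq_ty \<Gamma> (rTySub A (rId \<Gamma>)) A"
| conv_TmSub_Comp:
    "\<lbrakk>eq_tm \<Theta> a a A; eq_sub \<Delta> \<gamma> \<gamma> \<Theta>; eq_sub \<Gamma> \<delta> \<delta> \<Delta>\<rbrakk>
      \<Longrightarrow> eq_tm \<Gamma> (rTmSub a (rComp \<gamma> \<delta>)) (rTmSub (rTmSub a \<gamma>) \<delta>) (rTySub A (rComp \<gamma> \<delta>))"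
| conv_TmSub_Id: "eq_tm \<Gamma> a a A \<Longrightarrow> eq_tm \<Gamma> (rTmSub a (rId \<Gamma>)) a A"
| conv_Bang: "eq_sub \<Gamma> \<gamma> \<gamma> rOne \<Longrightarrow> eq_sub \<Gamma> \<gamma> (rBang \<Gamma>) rOne"
| conv_P_Pair:
    "\<lbrakk>eq_ty \<Gamma> A A; eq_sub \<Delta> \<gamma> \<gamma> \<Gamma>; eq_tm \<Delta> a a (rTySub A \<gamma>)\<rbrakk>
      \<Longrightarrow> eq_sub \<Delta> (rComp (rP A) (rPair A \<gamma> a)) \<gamma> \<Gamma>"
| conv_Q_Pair:
    "\<lbrakk>eq_ty \<Gamma> A A; eq_sub \<Delta> \<gamma> \<gamma> \<Gamma>; eq_tm \<Delta> a a (rTySub A \<gamma>)\<rbrakk>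
      \<Longrightarrow> eq_tm \<Delta> (rTmSub (rQ A) (rPair A \<gamma> a)) a (rTySub A \<gamma>)"
| conv_Pair_eta:
    "eq_sub \<Delta> \<gamma> \<gamma> (rExt \<Gamma> A)
      \<Longrightarrow> eq_sub \<Delta> \<gamma> (rPair A (rComp (rP A) \<gamma>) (rTmSub (rQ A) \<gamma>)) (rExt \<Gamma> A)"


section \<open>The syntactic cwf\<close>

text \<open>
  Derivable equality of raw expressions, relative to equivalence classes \<open>X\<close>, \<open>Y\<close> of contexts
  and \<open>K\<close> of types.  By the preservation rules it does not depend on the chosen
  representatives of these classes.  The relations are reflexive only on well-formed expressions.
\<close>

definition ctx_rel :: "raw_ctx rel" where
  "ctx_rel = {(\<Gamma>, \<Gamma>'). eq_ctx \<Gamma> \<Gamma>'}"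

definition sub_rel :: "raw_ctx set \<Rightarrow> raw_ctx set \<Rightarrow> raw_sub rel" where
  "sub_rel X Y = {(\<gamma>, \<gamma>'). \<exists>\<Gamma>\<in>X. \<exists>\<Delta>\<in>Y. eq_sub \<Gamma> \<gamma> \<gamma>' \<Delta>}"

definition ty_rel :: "raw_ctx set \<Rightarrow> raw_ty rel" where
  "ty_rel X = {(A, A'). \<exists>\<Gamma>\<in>X. eq_ty \<Gamma> A A'}"

definition tm_rel :: "raw_ctx set \<Rightarrow> raw_ty set \<Rightarrow> raw_tm rel" where
  "tm_rel X K = {(a, a'). \<exists>\<Gamma>\<in>X. \<exists>A\<in>K. eq_tm \<Gamma> a a' A}"

text \<open>
  Operations on equivalence classes are given by the union, over all representatives of the
  arguments, of the class of the resulting raw expression; all these classes coincide because of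
  the congruence rules.
\<close>

definition syn_One :: "raw_ctx set" where
  "syn_One = ctx_rel `` {rOne}"

definition syn_Ext :: "raw_ctx set \<Rightarrow> raw_ty set \<Rightarrow> raw_ctx set" where
  "syn_Ext X K = (\<Union>\<Gamma>\<in>X. \<Union>A\<in>K. ctx_rel `` {rExt \<Gamma> A})"

definition syn_TySub ::
  "raw_ctx set \<Rightarrow> raw_ctx set \<Rightarrow> raw_ty set \<Rightarrow> raw_sub set \<Rightarrow> raw_ty set" where
  "syn_TySub X Y K g = (\<Union>A\<in>K. \<Union>\<gamma>\<in>g. ty_rel X `` {rTySub A \<gamma>})"

definition syn_P :: "raw_ctx set \<Rightarrow> raw_ty set \<Rightarrow> raw_sub set" where
  "syn_P X K = (\<Union>A\<in>K. sub_rel (syn_Ext X K) X `` {rP A})"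

definition syn_cwf :: "(raw_ctx set, raw_sub set, raw_ty set, raw_tm set) cwf_data" where
  "syn_cwf =
    \<lparr> Ctx = {\<Gamma>. eq_ctx \<Gamma> \<Gamma>} // ctx_rel,
      Sub = (\<lambda>X Y. {\<gamma>. (\<gamma>, \<gamma>) \<in> sub_rel X Y} // sub_rel X Y),
      Id = (\<lambda>X. \<Union>\<Gamma>\<in>X. sub_rel X X `` {rId \<Gamma>}),
      Comp = (\<lambda>X Y Z g d. \<Union>\<gamma>\<in>g. \<Union>\<delta>\<in>d. sub_rel X Z `` {rComp \<gamma> \<delta>}),
      Ty = (\<lambda>X. {A. (A, A) \<in> ty_rel X} // ty_rel X),
      Tm = (\<lambda>X K. {a. (a, a) \<in> tm_rel X K} // tm_rel X K),
      TySub = syn_TySub,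
      TmSub = (\<lambda>X Y K t g. \<Union>a\<in>t. \<Union>\<gamma>\<in>g. tm_rel X (syn_TySub X Y K g) `` {rTmSub a \<gamma>}),
      One = syn_One,
      Ext = syn_Ext,
      P = syn_P,
      Q = (\<lambda>X K. \<Union>A\<in>K. tm_rel (syn_Ext X K) (syn_TySub (syn_Ext X K) X K (syn_P X K)) `` {rQ A}) \<rparr>"

definition syn_base :: "raw_ty set" where
  "syn_base = ty_rel syn_One `` {rBase}"

end

theory Submission
  imports Defs
begin

text \<open>
  For existence, the raw syntax is interpreted by structural recursion.  This is possible because a
  raw substitution carries enough annotations to determine its domain and codomain, a raw type its
  context, and a raw term its context and type: the interpretation returns these indices as well,
  and a simultaneous induction on derivations shows that derivably equal expressions have equal
  interpretations, with the expected indices.  For uniqueness, another induction on derivations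
  shows that two strict morphisms agreeing on the base type agree everywhere; they agree on
  \<open>\<langle>\<gamma>, a\<rangle>\<^sub>A\<close> and \<open>\<langle>\<rangle>\<^sub>\<Gamma>\<close> by the universal properties in the target.
\<close>

section \<open>The syntactic cwf\<close>

text \<open>Many rules leave the well-formedness of contexts and types implicit. A simultaneous
  induction on derivations recovers it, each case being closed by the rules themselves.\<close>

lemma presup:
  "eq_ctx \<Gamma> \<Gamma>' \<Longrightarrow> eq_ctx \<Gamma> \<Gamma>"
  "eq_sub \<Gamma> \<gamma> \<gamma>' \<Delta> \<Longrightarrow> eq_ctx \<Gamma> \<Gamma> \<and> eq_ctx \<Delta> \<Delta>"
  "eq_ty \<Gamma> A A' \<Longrightarrow> eq_ctx \<Gamma> \<Gamma>"
  "eq_tm \<Gamma> a a' A \<Longrightarrow> eq_ctx \<Gamma> \<Gamma> \<and> eq_ty \<Gamma> A A"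
proof (induction rule: eq_ctx_eq_sub_eq_ty_eq_tm.inducts)
qed (meson eq_ctx_eq_sub_eq_ty_eq_tm.intros)+

text \<open>There is no reflexivity rule; symmetry and transitivity make each judgment reflexive on
  its field. This feeds equations into lemmas stated for well-formed expressions.\<close>

lemma refl_left:
  "eq_ctx \<Gamma> \<Gamma>' \<Longrightarrow> eq_ctx \<Gamma> \<Gamma>"
  "eq_sub \<Gamma> \<gamma> \<gamma>' \<Delta> \<Longrightarrow> eq_sub \<Gamma> \<gamma> \<gamma> \<Delta>"
  "eq_ty \<Gamma> A A' \<Longrightarrow> eq_ty \<Gamma> A A"
  "eq_tm \<Gamma> a a' A \<Longrightarrow> eq_tm \<Gamma> a a A"
  by (meson eq_ctx_eq_sub_eq_ty_eq_tm.intros)+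

section \<open>Equivalence classes named by raw representatives\<close>

text \<open>These four classes are indexed by raw contexts and types, not by classes of them, so
  that membership is a single judgment. An ill-formed expression gets the empty class.\<close>

definition ctx_class :: "raw_ctx \<Rightarrow> raw_ctx set" where
  "ctx_class \<Gamma> = {\<Gamma>'. eq_ctx \<Gamma> \<Gamma>'}"

definition sub_class :: "raw_ctx \<Rightarrow> raw_ctx \<Rightarrow> raw_sub \<Rightarrow> raw_sub set" where
  "sub_class \<Gamma> \<Delta> \<gamma> = {\<gamma>'. eq_sub \<Gamma> \<gamma> \<gamma>' \<Delta>}"

definition ty_class :: "raw_ctx \<Rightarrow> raw_ty \<Rightarrow> raw_ty set" where
  "ty_class \<Gamma> A = {A'. eq_ty \<Gamma> A A'}"

definition tm_class :: "raw_ctx \<Rightarrow> raw_ty \<Rightarrow> raw_tm \<Rightarrow> raw_tm set" where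
  "tm_class \<Gamma> A a = {a'. eq_tm \<Gamma> a a' A}"

lemma mem_class_iff [simp]:
  "\<Gamma>' \<in> ctx_class \<Gamma> \<longleftrightarrow> eq_ctx \<Gamma> \<Gamma>'"
  "\<gamma>' \<in> sub_class \<Gamma> \<Delta> \<gamma> \<longleftrightarrow> eq_sub \<Gamma> \<gamma> \<gamma>' \<Delta>"
  "A' \<in> ty_class \<Gamma> A \<longleftrightarrow> eq_ty \<Gamma> A A'"
  "a' \<in> tm_class \<Gamma> A a \<longleftrightarrow> eq_tm \<Gamma> a a' A"
  by (auto simp: ctx_class_def sub_class_def ty_class_def tm_class_def)

lemma ctx_class_eq: "eq_ctx \<Gamma> \<Gamma>' \<Longrightarrow> ctx_class \<Gamma> = ctx_class \<Gamma>'"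
  by (simp add: set_eq_iff) (metis ctx_sym ctx_trans)

lemma sub_class_eq: "eq_sub \<Gamma> \<gamma> \<gamma>' \<Delta> \<Longrightarrow> sub_class \<Gamma> \<Delta> \<gamma> = sub_class \<Gamma> \<Delta> \<gamma>'"
  by (simp add: set_eq_iff) (metis sub_sym sub_trans)

lemma ty_class_eq: "eq_ty \<Gamma> A A' \<Longrightarrow> ty_class \<Gamma> A = ty_class \<Gamma> A'"
  by (simp add: set_eq_iff) (metis ty_sym ty_trans)

lemma tm_class_eq: "eq_tm \<Gamma> a a' A \<Longrightarrow> tm_class \<Gamma> A a = tm_class \<Gamma> A a'"
  by (simp add: set_eq_iff) (metis tm_sym tm_trans)

lemma sub_class_pres:
  "eq_ctx \<Gamma> \<Gamma>' \<Longrightarrow> eq_ctx \<Delta> \<Delta>' \<Longrightarrow> sub_class \<Gamma> \<Delta> \<gamma> = sub_class \<Gamma>' \<Delta>' \<gamma>"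
  by (simp add: set_eq_iff) (metis sub_pres ctx_sym)

lemma ty_class_pres: "eq_ctx \<Gamma> \<Gamma>' \<Longrightarrow> ty_class \<Gamma> A = ty_class \<Gamma>' A"
  by (simp add: set_eq_iff) (metis ty_pres ctx_sym)

text \<open>Preservation works in both directions. The lemma bridges terms that live over derivably
  equal but different raw types, such as A[id] and A.\<close>

lemma tm_class_pres:
  "eq_ctx \<Gamma> \<Gamma>' \<Longrightarrow> eq_ty \<Gamma> A A' \<Longrightarrow> tm_class \<Gamma> A a = tm_class \<Gamma>' A' a"
  by (simp add: set_eq_iff) (metis tm_pres ty_pres ctx_sym ty_sym)

text \<open>Well-formedness puts \<gamma>' into its own class; two ill-formed substitutions would
  share the empty class without being derivably equal.\<close>

lemma sub_class_iff:
  "eq_sub \<Gamma> \<gamma>' \<gamma>' \<Delta> \<Longrightarrow> sub_class \<Gamma> \<Delta> \<gamma> = sub_class \<Gamma> \<Delta> \<gamma>' \<longleftrightarrow> eq_sub \<Gamma> \<gamma> \<gamma>' \<Delta>"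
  using sub_class_eq by (metis mem_class_iff(2))

lemma tm_class_iff:
  "eq_tm \<Gamma> a' a' A \<Longrightarrow> tm_class \<Gamma> A a = tm_class \<Gamma> A a' \<longleftrightarrow> eq_tm \<Gamma> a a' A"
  using tm_class_eq by (metis mem_class_iff(4))

lemma ctx_rel_image [simp]: "ctx_rel `` {\<Gamma>} = ctx_class \<Gamma>"
  by (auto simp: ctx_rel_def ctx_class_def)

text \<open>Preservation moves a derivation from arbitrary representatives to \<Gamma> and \<Delta>,
  so the existential quantifiers collapse; conversely, presuppositions put \<Gamma> and \<Delta>
  into their own classes.\<close>

lemma sub_rel_class:
  "sub_rel (ctx_class \<Gamma>) (ctx_class \<Delta>) = {(\<gamma>, \<gamma>'). eq_sub \<Gamma> \<gamma> \<gamma>' \<Delta>}"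
  by (simp add: sub_rel_def set_eq_iff Bex_def) (metis presup(2) sub_pres ctx_sym)

lemma ty_rel_class: "ty_rel (ctx_class \<Gamma>) = {(A, A'). eq_ty \<Gamma> A A'}"
  by (simp add: ty_rel_def set_eq_iff Bex_def) (metis presup(3) ty_pres ctx_sym)

lemma tm_rel_class:
  "tm_rel (ctx_class \<Gamma>) (ty_class \<Gamma> A) = {(a, a'). eq_tm \<Gamma> a a' A}"
  by (simp add: tm_rel_def set_eq_iff Bex_def) (metis presup(3,4) tm_pres ctx_sym ty_sym ty_pres)

lemma rel_image [simp]:
  "sub_rel (ctx_class \<Gamma>) (ctx_class \<Delta>) `` {\<gamma>} = sub_class \<Gamma> \<Delta> \<gamma>"
  "ty_rel (ctx_class \<Gamma>) `` {A} = ty_class \<Gamma> A"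
  "tm_rel (ctx_class \<Gamma>) (ty_class \<Gamma> A) `` {a} = tm_class \<Gamma> A a"
  by (auto simp: sub_rel_class ty_rel_class tm_rel_class)

text \<open>Evaluates the operations of \<open>syn_cwf\<close>, which are unions over
  representatives: one representative makes the union nonempty, and the congruence rules make all
  its members equal.\<close>

lemma UN_const: "x \<in> X \<Longrightarrow> (\<And>y. y \<in> X \<Longrightarrow> f y = c) \<Longrightarrow> (\<Union>y\<in>X. f y) = c"
  by auto

section \<open>Carriers and operations of \<open>syn_cwf\<close> on representatives\<close>

lemma syn_Ctx: "Ctx syn_cwf = {ctx_class \<Gamma> |\<Gamma>. eq_ctx \<Gamma> \<Gamma>}"
  by (auto simp: syn_cwf_def quotient_def)

lemma syn_Sub:
  "Sub syn_cwf (ctx_class \<Gamma>) (ctx_class \<Delta>) = {sub_class \<Gamma> \<Delta> \<gamma> |\<gamma>. eq_sub \<Gamma> \<gamma> \<gamma> \<Delta>}"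
  by (auto simp: syn_cwf_def quotient_def sub_rel_class sub_class_def)

lemma syn_Ty: "Ty syn_cwf (ctx_class \<Gamma>) = {ty_class \<Gamma> A |A. eq_ty \<Gamma> A A}"
  by (auto simp: syn_cwf_def quotient_def ty_rel_class ty_class_def)

lemma syn_Tm:
  "Tm syn_cwf (ctx_class \<Gamma>) (ty_class \<Gamma> A) = {tm_class \<Gamma> A a |a. eq_tm \<Gamma> a a A}"
  by (auto simp: syn_cwf_def quotient_def tm_rel_class tm_class_def)

lemma syn_Id:
  assumes "eq_ctx \<Gamma> \<Gamma>"
  shows "Id syn_cwf (ctx_class \<Gamma>) = sub_class \<Gamma> \<Gamma> (rId \<Gamma>)"
  unfolding syn_cwf_def cwf_data.simps
proof (rule UN_const[OF mem_class_iff(1)[THEN iffD2, OF assms]])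
  fix \<Gamma>' assume "\<Gamma>' \<in> ctx_class \<Gamma>"
  then show "sub_rel (ctx_class \<Gamma>) (ctx_class \<Gamma>) `` {rId \<Gamma>'} = sub_class \<Gamma> \<Gamma> (rId \<Gamma>)"
    \<comment> \<open>\<open>equalityI\<close> is deleted so that the equation of classes stays one
      goal for \<open>sub_class_eq\<close> instead of splitting into two inclusions.\<close>
    by (auto intro!: sub_class_eq[OF cong_Id, symmetric] del: equalityI)
qed

lemma syn_Comp:
  assumes "eq_sub \<Gamma> \<delta> \<delta> \<Delta>" "eq_sub \<Delta> \<gamma> \<gamma> \<Theta>"
  shows "Comp syn_cwf (ctx_class \<Gamma>) (ctx_class \<Delta>) (ctx_class \<Theta>) (sub_class \<Delta> \<Theta> \<gamma>) (sub_class \<Gamma> \<Delta> \<delta>)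
    = sub_class \<Gamma> \<Theta> (rComp \<gamma> \<delta>)"
  unfolding syn_cwf_def cwf_data.simps
proof (rule UN_const[OF mem_class_iff(2)[THEN iffD2, OF assms(2)]],
    rule UN_const[OF mem_class_iff(2)[THEN iffD2, OF assms(1)]])
  fix \<gamma>' \<delta>' assume "\<gamma>' \<in> sub_class \<Delta> \<Theta> \<gamma>" "\<delta>' \<in> sub_class \<Gamma> \<Delta> \<delta>"
  then show "sub_rel (ctx_class \<Gamma>) (ctx_class \<Theta>) `` {rComp \<gamma>' \<delta>'} = sub_class \<Gamma> \<Theta> (rComp \<gamma> \<delta>)"
    by (auto intro!: sub_class_eq[OF cong_Comp, symmetric] del: equalityI)
qed

text \<open>Stated for the auxiliary constant because the index types inside \<open>TmSub\<close>
  and \<open>Q\<close> of \<open>syn_cwf\<close> mention it rather than the record field.\<close>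

lemma syn_TySub_class:
  assumes "eq_sub \<Gamma> \<gamma> \<gamma> \<Delta>" "eq_ty \<Delta> A A"
  shows "syn_TySub (ctx_class \<Gamma>) (ctx_class \<Delta>) (ty_class \<Delta> A) (sub_class \<Gamma> \<Delta> \<gamma>)
    = ty_class \<Gamma> (rTySub A \<gamma>)"
  unfolding syn_TySub_def
proof (rule UN_const[OF mem_class_iff(3)[THEN iffD2, OF assms(2)]],
    rule UN_const[OF mem_class_iff(2)[THEN iffD2, OF assms(1)]])
  fix \<gamma>' A' assume "A' \<in> ty_class \<Delta> A" "\<gamma>' \<in> sub_class \<Gamma> \<Delta> \<gamma>"
  then show "ty_rel (ctx_class \<Gamma>) `` {rTySub A' \<gamma>'} = ty_class \<Gamma> (rTySub A \<gamma>)"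
    by (auto intro!: ty_class_eq[OF cong_TySub, symmetric] del: equalityI)
qed

lemma syn_TySub:
  assumes "eq_sub \<Gamma> \<gamma> \<gamma> \<Delta>" "eq_ty \<Delta> A A"
  shows "TySub syn_cwf (ctx_class \<Gamma>) (ctx_class \<Delta>) (ty_class \<Delta> A) (sub_class \<Gamma> \<Delta> \<gamma>)
    = ty_class \<Gamma> (rTySub A \<gamma>)"
  using syn_TySub_class[OF assms] by (simp add: syn_cwf_def)

lemma syn_TmSub:
  assumes "eq_sub \<Gamma> \<gamma> \<gamma> \<Delta>" "eq_tm \<Delta> a a A"
  shows "TmSub syn_cwf (ctx_class \<Gamma>) (ctx_class \<Delta>) (ty_class \<Delta> A) (tm_class \<Delta> A a) (sub_class \<Gamma> \<Delta> \<gamma>)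
    = tm_class \<Gamma> (rTySub A \<gamma>) (rTmSub a \<gamma>)"
  unfolding syn_cwf_def cwf_data.simps
proof (rule UN_const[OF mem_class_iff(4)[THEN iffD2, OF assms(2)]],
    rule UN_const[OF mem_class_iff(2)[THEN iffD2, OF assms(1)]])
  fix \<gamma>' a' assume "a' \<in> tm_class \<Delta> A a" "\<gamma>' \<in> sub_class \<Gamma> \<Delta> \<gamma>"
  then show "tm_rel (ctx_class \<Gamma>)
      (syn_TySub (ctx_class \<Gamma>) (ctx_class \<Delta>) (ty_class \<Delta> A) (sub_class \<Gamma> \<Delta> \<gamma>)) `` {rTmSub a' \<gamma>'}
      = tm_class \<Gamma> (rTySub A \<gamma>) (rTmSub a \<gamma>)"
    \<comment> \<open>The index type of the relation has to be evaluated first, which requires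
      \<open>A\<close> to be well formed over \<Delta>.\<close>
    using presup(4)[OF assms(2)] assms(1)
      by (auto simp: syn_TySub_class
        intro!: tm_class_eq[OF cong_TmSub, symmetric] del: equalityI)
qed

lemma syn_One_class: "One syn_cwf = ctx_class rOne"
  by (simp add: syn_cwf_def syn_One_def)

lemma syn_Ext_class:
  assumes "eq_ty \<Gamma> A A"
  shows "syn_Ext (ctx_class \<Gamma>) (ty_class \<Gamma> A) = ctx_class (rExt \<Gamma> A)"
  unfolding syn_Ext_def
proof (rule UN_const[OF mem_class_iff(1)[THEN iffD2, OF presup(3)[OF assms]]],
    rule UN_const[OF mem_class_iff(3)[THEN iffD2, OF assms]])
  fix \<Gamma>' A' assume "\<Gamma>' \<in> ctx_class \<Gamma>" "A' \<in> ty_class \<Gamma> A"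
  then show "ctx_rel `` {rExt \<Gamma>' A'} = ctx_class (rExt \<Gamma> A)"
    by (auto intro!: ctx_class_eq[OF cong_Ext, symmetric] del: equalityI)
qed

lemma syn_Ext:
  assumes "eq_ty \<Gamma> A A"
  shows "Ext syn_cwf (ctx_class \<Gamma>) (ty_class \<Gamma> A) = ctx_class (rExt \<Gamma> A)"
  using syn_Ext_class[OF assms] by (simp add: syn_cwf_def)

lemma syn_P_class:
  assumes "eq_ty \<Gamma> A A"
  shows "syn_P (ctx_class \<Gamma>) (ty_class \<Gamma> A) = sub_class (rExt \<Gamma> A) \<Gamma> (rP A)"
  unfolding syn_P_def
proof (rule UN_const[OF mem_class_iff(3)[THEN iffD2, OF assms]])
  fix A' assume "A' \<in> ty_class \<Gamma> A"
  then show "sub_rel (syn_Ext (ctx_class \<Gamma>) (ty_class \<Gamma> A)) (ctx_class \<Gamma>) `` {rP A'}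
      = sub_class (rExt \<Gamma> A) \<Gamma> (rP A)"
    using assms
      by (auto simp: syn_Ext_class intro!: sub_class_eq[OF cong_P, symmetric] del: equalityI)
qed

lemma syn_P:
  assumes "eq_ty \<Gamma> A A"
  shows "P syn_cwf (ctx_class \<Gamma>) (ty_class \<Gamma> A) = sub_class (rExt \<Gamma> A) \<Gamma> (rP A)"
  using syn_P_class[OF assms] by (simp add: syn_cwf_def)

lemma syn_Q:
  assumes "eq_ty \<Gamma> A A"
  shows "Q syn_cwf (ctx_class \<Gamma>) (ty_class \<Gamma> A) = tm_class (rExt \<Gamma> A) (rTySub A (rP A)) (rQ A)"
  unfolding syn_cwf_def cwf_data.simps
proof (rule UN_const[OF mem_class_iff(3)[THEN iffD2, OF assms]])
  fix A' assume "A' \<in> ty_class \<Gamma> A"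
  then show "tm_rel (syn_Ext (ctx_class \<Gamma>) (ty_class \<Gamma> A))
       (syn_TySub (syn_Ext (ctx_class \<Gamma>) (ty_class \<Gamma> A)) (ctx_class \<Gamma>) (ty_class \<Gamma> A)
         (syn_P (ctx_class \<Gamma>) (ty_class \<Gamma> A))) `` {rQ A'}
      = tm_class (rExt \<Gamma> A) (rTySub A (rP A)) (rQ A)"
    using assms cong_P[OF assms]
      by (auto simp: syn_Ext_class syn_P_class syn_TySub_class
        intro!: tm_class_eq[OF cong_Q, symmetric] del: equalityI)
qed

lemmas syn_sels = syn_Ctx syn_Sub syn_Ty syn_Tm syn_Id syn_Comp syn_TySub syn_TmSub
  syn_One_class syn_Ext syn_P syn_Q

lemma syn_mem:
  "eq_ctx \<Gamma> \<Gamma> \<Longrightarrow> ctx_class \<Gamma> \<in> Ctx syn_cwf"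
  "eq_sub \<Gamma> \<gamma> \<gamma> \<Delta> \<Longrightarrow> sub_class \<Gamma> \<Delta> \<gamma> \<in> Sub syn_cwf (ctx_class \<Gamma>) (ctx_class \<Delta>)"
  "eq_ty \<Gamma> A A \<Longrightarrow> ty_class \<Gamma> A \<in> Ty syn_cwf (ctx_class \<Gamma>)"
  "eq_tm \<Gamma> a a A \<Longrightarrow> tm_class \<Gamma> A a \<in> Tm syn_cwf (ctx_class \<Gamma>) (ty_class \<Gamma> A)"
  by (auto simp: syn_sels)

text \<open>This and the next three eliminators replace classes by representatives. They fire in
  order of dependency, since each matches only after its indices have been written as
  classes.\<close>

lemma syn_CtxE:
  assumes "X \<in> Ctx syn_cwf"
  obtains \<Gamma> where "X = ctx_class \<Gamma>" "eq_ctx \<Gamma> \<Gamma>"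
  using assms by (auto simp: syn_Ctx)

lemma syn_SubE:
  assumes "g \<in> Sub syn_cwf (ctx_class \<Gamma>) (ctx_class \<Delta>)"
  obtains \<gamma> where "g = sub_class \<Gamma> \<Delta> \<gamma>" "eq_sub \<Gamma> \<gamma> \<gamma> \<Delta>"
  using assms by (auto simp: syn_Sub)

lemma syn_TyE:
  assumes "K \<in> Ty syn_cwf (ctx_class \<Gamma>)"
  obtains A where "K = ty_class \<Gamma> A" "eq_ty \<Gamma> A A"
  using assms by (auto simp: syn_Ty)

lemma syn_TmE:
  assumes "t \<in> Tm syn_cwf (ctx_class \<Gamma>) (ty_class \<Gamma> A)"
  obtains a where "t = tm_class \<Gamma> A a" "eq_tm \<Gamma> a a A"
  using assms by (auto simp: syn_Tm)

section \<open>The universal property of context extension in the syntax\<close>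

text \<open>By the eta rule \<theta> equals the pair of its own components, and congruence of
  pairing replaces these by \<gamma> and \<open>a\<close>.\<close>

lemma eq_sub_Ext_unique:
  assumes A: "eq_ty \<Delta> A A" and t: "eq_sub \<Gamma> \<theta> \<theta> (rExt \<Delta> A)"
    and g: "eq_sub \<Gamma> (rComp (rP A) \<theta>) \<gamma> \<Delta>"
    and a: "eq_tm \<Gamma> (rTmSub (rQ A) \<theta>) a (rTySub A \<gamma>)"
  shows "eq_sub \<Gamma> \<theta> (rPair A \<gamma> a) (rExt \<Delta> A)"
proof -
  \<comment> \<open>\<open>cong_Pair\<close> wants the second components at the type formed with its
    left-hand substitution \<open>rComp (rP A) \<theta>\<close>, so the hypothesis on
    \<open>a\<close> is retyped.\<close>
  have "eq_ty \<Gamma> (rTySub A \<gamma>) (rTySub A (rComp (rP A) \<theta>))"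
    using cong_TySub[OF A sub_sym[OF g]] .
  then have "eq_tm \<Gamma> (rTmSub (rQ A) \<theta>) a (rTySub A (rComp (rP A) \<theta>))"
    using a presup(4) tm_pres by blast
  from sub_trans[OF conv_Pair_eta[OF t] cong_Pair[OF A g this]] show ?thesis .
qed

text \<open>Substituting \<theta> into \<open>rQ A\<close> yields a term of type A[p][\<theta>].
  Functoriality turns this type into A[p \<circ> \<theta>], and congruence into A[\<gamma>].\<close>

lemma eq_ty_TySub_P:
  assumes "eq_ty \<Delta> A A" "eq_sub \<Gamma> \<theta> \<theta> (rExt \<Delta> A)"
    and "eq_sub \<Gamma> (rComp (rP A) \<theta>) \<gamma> \<Delta>"
  shows "eq_ty \<Gamma> (rTySub (rTySub A (rP A)) \<theta>) (rTySub A \<gamma>)"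
  using ty_trans[OF ty_sym[OF conv_TySub_Comp[OF assms(1) cong_P[OF assms(1)] assms(2)]]
      cong_TySub[OF assms(1,3)]] .

text \<open>The raw pair satisfies the two equations by the beta rules, and eta makes it the only
  solution.\<close>

lemma syn_Ext_universal:
  assumes A: "eq_ty \<Delta> A A" and g: "eq_sub \<Gamma> \<gamma> \<gamma> \<Delta>" and a: "eq_tm \<Gamma> a a (rTySub A \<gamma>)"
  defines "G \<equiv> ctx_class \<Gamma>" and "D \<equiv> ctx_class \<Delta>" and "E \<equiv> ctx_class (rExt \<Delta> A)"
    and "K \<equiv> ty_class \<Delta> A"
  shows "\<exists>!\<theta>. \<theta> \<in> Sub syn_cwf G E
      \<and> Comp syn_cwf G E D (P syn_cwf D K) \<theta> = sub_class \<Gamma> \<Delta> \<gamma>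
      \<and> TmSub syn_cwf G E (TySub syn_cwf E D K (P syn_cwf D K)) (Q syn_cwf D K) \<theta>
        = tm_class \<Gamma> (rTySub A \<gamma>) a"
proof -
  note [simp] = G_def D_def E_def K_def
  note PA = cong_P[OF A] and QA = cong_Q[OF A]
  \<comment> \<open>For a well-formed representative \<theta> membership is automatic, and the two
    equations between classes become judgments about \<theta>.\<close>
  have key: "sub_class \<Gamma> (rExt \<Delta> A) \<theta> \<in> Sub syn_cwf G E
      \<and> Comp syn_cwf G E D (P syn_cwf D K) (sub_class \<Gamma> (rExt \<Delta> A) \<theta>) = sub_class \<Gamma> \<Delta> \<gamma>
      \<and> TmSub syn_cwf G E (TySub syn_cwf E D K (P syn_cwf D K)) (Q syn_cwf D K)
          (sub_class \<Gamma> (rExt \<Delta> A) \<theta>) = tm_class \<Gamma> (rTySub A \<gamma>) a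
    \<longleftrightarrow> eq_sub \<Gamma> (rComp (rP A) \<theta>) \<gamma> \<Delta> \<and> eq_tm \<Gamma> (rTmSub (rQ A) \<theta>) a (rTySub A \<gamma>)"
    if t: "eq_sub \<Gamma> \<theta> \<theta> (rExt \<Delta> A)" for \<theta>
  proof -
    \<comment> \<open>The second projection of \<theta> arises at type A[p][\<theta>], but
      \<open>a\<close> lives at A[\<gamma>]. The types are identified using p \<circ> \<theta> =
      \<gamma>, which is why \<open>conj_cong\<close> below rewrites the second equation under the
      first.\<close>
    have "tm_class \<Gamma> (rTySub (rTySub A (rP A)) \<theta>) (rTmSub (rQ A) \<theta>)
        = tm_class \<Gamma> (rTySub A \<gamma>) (rTmSub (rQ A) \<theta>)"
      if "eq_sub \<Gamma> (rComp (rP A) \<theta>) \<gamma> \<Delta>"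
    proof (rule tm_class_pres)
      show e: "eq_ty \<Gamma> (rTySub (rTySub A (rP A)) \<theta>) (rTySub A \<gamma>)"
        by (rule eq_ty_TySub_P[OF A t that])
      show "eq_ctx \<Gamma> \<Gamma>" by (rule presup(3)[OF e])
    qed
    then show ?thesis
      using A t PA QA g a
      by (simp add: syn_P syn_Q syn_Comp syn_TySub syn_TmSub sub_class_iff syn_mem
          cong: conj_cong) (simp add: tm_class_iff cong: conj_cong)
  qed
  have pair: "eq_sub \<Gamma> (rPair A \<gamma> a) (rPair A \<gamma> a) (rExt \<Delta> A)"
    using cong_Pair[OF A g a] .
  show ?thesis
  proof (rule ex1I[of _ "sub_class \<Gamma> (rExt \<Delta> A) (rPair A \<gamma> a)"], goal_cases)
    case 1
    show ?case using key[OF pair] conv_P_Pair[OF A g a] conv_Q_Pair[OF A g a] by blast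
  next
    case (2 th)
    then obtain \<theta> where th: "th = sub_class \<Gamma> (rExt \<Delta> A) \<theta>" and t: "eq_sub \<Gamma> \<theta> \<theta> (rExt \<Delta> A)"
      by (auto elim: syn_SubE)
    have "eq_sub \<Gamma> \<theta> (rPair A \<gamma> a) (rExt \<Delta> A)"
      using 2[unfolded th] key[OF t] by (intro eq_sub_Ext_unique[OF A t]) simp_all
    then show ?case using sub_class_eq th by blast
  qed
qed

section \<open>The cwf laws for \<open>syn_cwf\<close>\<close>

text \<open>On representatives the closure conditions are congruence rules and the equations are
  conversion rules. The functor laws for terms also need a change of type, because their two sides
  live over different raw types.\<close>

lemma cwf_syn: "cwf syn_cwf"
proof (unfold_locales, goal_cases)
  case (1 X) then show ?case
    by (auto elim!: syn_CtxE simp: syn_Id intro!: syn_mem cong_Id)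
next
  case (2 X Y Z d g) then show ?case
    by (auto elim!: syn_CtxE syn_SubE simp: syn_Comp intro!: syn_mem cong_Comp)
next
  case (3 X Y Z W g d t) then show ?case
    by (auto elim!: syn_CtxE syn_SubE simp: syn_Comp cong_Comp intro!: sub_class_eq conv_assoc del: equalityI)
next
  case (4 X Y g) then show ?case
    by (auto elim!: syn_CtxE syn_SubE simp: syn_Comp syn_Id cong_Id
        intro!: sub_class_eq sub_sym[OF conv_Id_Comp] del: equalityI)
next
  case (5 X Y g) then show ?case
    by (auto elim!: syn_CtxE syn_SubE simp: syn_Comp syn_Id cong_Id
        intro!: sub_class_eq sub_sym[OF conv_Comp_Id] del: equalityI)
next
  case (6 X Y g K) then show ?case
    by (auto elim!: syn_CtxE syn_SubE syn_TyE simp: syn_TySub intro!: syn_mem cong_TySub)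
next
  case (7 X K) then show ?case
    by (auto elim!: syn_CtxE syn_TyE simp: syn_TySub syn_Id cong_Id
        intro!: ty_class_eq conv_TySub_Id del: equalityI)
next
  case (8 X Y Z d g K) then show ?case
    by (auto elim!: syn_CtxE syn_SubE syn_TyE simp: syn_TySub syn_Comp cong_Comp cong_TySub
        intro!: ty_class_eq conv_TySub_Comp del: equalityI)
next
  case (9 X Y g K t) then show ?case
    by (auto elim!: syn_CtxE syn_SubE syn_TyE syn_TmE simp: syn_TySub syn_TmSub
        intro!: syn_mem cong_TmSub)
next
  case (10 X K t)
  then obtain \<Gamma> A a where [simp]: "X = ctx_class \<Gamma>" "K = ty_class \<Gamma> A" "t = tm_class \<Gamma> A a"
    and h: "eq_ctx \<Gamma> \<Gamma>" "eq_ty \<Gamma> A A" "eq_tm \<Gamma> a a A"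
    by (auto elim!: syn_CtxE syn_TyE syn_TmE)
  \<comment> \<open>\<open>TmSub\<close> returns a class at type A[id]; it is moved to A, where the
    conversion rule is stated.\<close>
  have "tm_class \<Gamma> (rTySub A (rId \<Gamma>)) (rTmSub a (rId \<Gamma>)) = tm_class \<Gamma> A (rTmSub a (rId \<Gamma>))"
    using tm_class_pres[OF h(1) conv_TySub_Id[OF h(2)]] .
  then show ?case
    using h tm_class_eq[OF conv_TmSub_Id[OF h(3)]] by (simp add: syn_Id syn_TmSub cong_Id)
next
  case (11 X Y Z d g K t)
  then obtain \<Gamma> \<Delta> \<Theta> \<delta> \<gamma> A a where [simp]: "X = ctx_class \<Gamma>" "Y = ctx_class \<Delta>" "Z = ctx_class \<Theta>"
    "d = sub_class \<Gamma> \<Delta> \<delta>" "g = sub_class \<Delta> \<Theta> \<gamma>" "K = ty_class \<Theta> A" "t = tm_class \<Theta> A a"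
    and h: "eq_ctx \<Gamma> \<Gamma>" "eq_sub \<Gamma> \<delta> \<delta> \<Delta>" "eq_sub \<Delta> \<gamma> \<gamma> \<Theta>" "eq_ty \<Theta> A A" "eq_tm \<Theta> a a A"
    by (auto elim!: syn_CtxE syn_SubE syn_TyE syn_TmE)
  \<comment> \<open>The conversion rule acts at type A[\<gamma> \<circ> \<delta>]; the result is
    then moved to A[\<gamma>][\<delta>], the type of the iterated substitution.\<close>
  have "tm_class \<Gamma> (rTySub A (rComp \<gamma> \<delta>)) (rTmSub a (rComp \<gamma> \<delta>))
      = tm_class \<Gamma> (rTySub A (rComp \<gamma> \<delta>)) (rTmSub (rTmSub a \<gamma>) \<delta>)"
    using tm_class_eq[OF conv_TmSub_Comp[OF h(5,3,2)]] .
  also have "\<dots> = tm_class \<Gamma> (rTySub (rTySub A \<gamma>) \<delta>) (rTmSub (rTmSub a \<gamma>) \<delta>)"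
    using tm_class_pres[OF h(1) conv_TySub_Comp[OF h(4,3,2)]] .
  finally show ?case
    using h by (simp add: syn_Comp syn_TmSub syn_TySub cong_Comp cong_TmSub)
next
  case 12 then show ?case by (simp add: syn_One_class syn_mem cong_One)
next
  case (13 X)
  then obtain \<Gamma> where X: "X = ctx_class \<Gamma>" and G: "eq_ctx \<Gamma> \<Gamma>"
    by (auto elim: syn_CtxE)
  show ?case
    unfolding X syn_One_class
  proof (rule ex1I[of _ "sub_class \<Gamma> rOne (rBang \<Gamma>)"])
    show "sub_class \<Gamma> rOne (rBang \<Gamma>) \<in> Sub syn_cwf (ctx_class \<Gamma>) (ctx_class rOne)"
      using syn_mem(2)[OF cong_Bang[OF G]] .
  next
    fix g assume "g \<in> Sub syn_cwf (ctx_class \<Gamma>) (ctx_class rOne)"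
    then show "g = sub_class \<Gamma> rOne (rBang \<Gamma>)"
      by (auto elim!: syn_SubE intro!: sub_class_eq conv_Bang del: equalityI)
  qed
next
  case (14 X K) then show ?case
    by (auto elim!: syn_CtxE syn_TyE simp: syn_Ext intro!: syn_mem cong_Ext)
next
  case (15 X K) then show ?case
    by (auto elim!: syn_CtxE syn_TyE simp: syn_Ext syn_P intro!: syn_mem cong_P)
next
  case (16 X K) then show ?case
    by (auto elim!: syn_CtxE syn_TyE simp: syn_Ext syn_P syn_Q syn_TySub cong_P
        intro!: syn_mem cong_Q)
next
  case (17 X Y K g t)
  then obtain \<Gamma> \<Delta> \<gamma> A a where [simp]: "X = ctx_class \<Gamma>" "Y = ctx_class \<Delta>"
    "g = sub_class \<Gamma> \<Delta> \<gamma>" "K = ty_class \<Delta> A" "t = tm_class \<Gamma> (rTySub A \<gamma>) a"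
    and h: "eq_ty \<Delta> A A" "eq_sub \<Gamma> \<gamma> \<gamma> \<Delta>" "eq_tm \<Gamma> a a (rTySub A \<gamma>)"
    by (auto elim!: syn_CtxE syn_SubE syn_TyE syn_TmE simp: syn_TySub)
  show ?case using syn_Ext_universal[OF h] h by (simp add: syn_Ext)
qed

section \<open>Uniqueness\<close>

text \<open>The projections p and q are jointly monic: both substitutions are the unique
  factorization of the pair consisting of p \<circ> \<theta> and q[\<theta>].\<close>

lemma (in cwf) Ext_eqI:
  assumes "\<Gamma> \<in> Ctx C" "\<Delta> \<in> Ctx C" "A \<in> Ty C \<Delta>"
    and "\<theta> \<in> Sub C \<Gamma> (Ext C \<Delta> A)" "\<theta>' \<in> Sub C \<Gamma> (Ext C \<Delta> A)"
    and "Comp C \<Gamma> (Ext C \<Delta> A) \<Delta> (P C \<Delta> A) \<theta> = Comp C \<Gamma> (Ext C \<Delta> A) \<Delta> (P C \<Delta> A) \<theta>'"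
    and "TmSub C \<Gamma> (Ext C \<Delta> A) (TySub C (Ext C \<Delta> A) \<Delta> A (P C \<Delta> A)) (Q C \<Delta> A) \<theta>
      = TmSub C \<Gamma> (Ext C \<Delta> A) (TySub C (Ext C \<Delta> A) \<Delta> A (P C \<Delta> A)) (Q C \<Delta> A) \<theta>'"
  shows "\<theta> = \<theta>'"
proof -
  let ?E = "Ext C \<Delta> A" and ?p = "P C \<Delta> A"
  have E: "?E \<in> Ctx C" and p: "?p \<in> Sub C ?E \<Delta>"
    using assms Ext_closed P_closed by auto
  \<comment> \<open>The universal property asks for q[\<theta>] at type A[p \<circ> \<theta>], so
    the type A[p][\<theta>] is rewritten by functoriality.\<close>
  have "TmSub C \<Gamma> ?E (TySub C ?E \<Delta> A ?p) (Q C \<Delta> A) \<theta> \<in> Tm C \<Gamma> (TySub C \<Gamma> ?E (TySub C ?E \<Delta> A ?p) \<theta>)"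
    using assms E p by (intro TmSub_closed TySub_closed Q_closed) auto
  also have "TySub C \<Gamma> ?E (TySub C ?E \<Delta> A ?p) \<theta> = TySub C \<Gamma> \<Delta> A (Comp C \<Gamma> ?E \<Delta> ?p \<theta>)"
    by (rule TySub_Comp[symmetric]) (use assms E p in auto)
  finally show ?thesis
    using Ext_universal[OF assms(1-3) Comp_closed[OF assms(1) E assms(2,4) p]] assms by metis
qed

context strict_cwf_morphism
begin

lemma FCtx_in: "\<Gamma> \<in> Ctx C \<Longrightarrow> FCtx F \<Gamma> \<in> Ctx D"
  using FCtx_fun by auto

lemma FSub_in: "\<Gamma> \<in> Ctx C \<Longrightarrow> \<Delta> \<in> Ctx C \<Longrightarrow> \<gamma> \<in> Sub C \<Gamma> \<Delta>
    \<Longrightarrow> FSub F \<Gamma> \<Delta> \<gamma> \<in> Sub D (FCtx F \<Gamma>) (FCtx F \<Delta>)"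
  using FSub_fun by (fastforce simp: PiE_iff)

lemma FTy_in: "\<Gamma> \<in> Ctx C \<Longrightarrow> A \<in> Ty C \<Gamma> \<Longrightarrow> FTy F \<Gamma> A \<in> Ty D (FCtx F \<Gamma>)"
  using FTy_fun by (fastforce simp: PiE_iff)

end

text \<open>The components are extensional, so agreement on the carriers, applied one argument at a
  time, gives equality of records.\<close>

lemma strict_cwf_morphism_eqI:
  fixes F G :: "('c, 's, 't, 'm, 'c1, 's1, 't1, 'm1) cwf_maps"
  assumes "strict_cwf_morphism C D F" "strict_cwf_morphism C D G"
    and ctx: "\<And>\<Gamma>. \<Gamma> \<in> Ctx C \<Longrightarrow> FCtx F \<Gamma> = FCtx G \<Gamma>"
    and sub: "\<And>\<Gamma> \<Delta> \<gamma>. \<lbrakk>\<Gamma> \<in> Ctx C; \<Delta> \<in> Ctx C; \<gamma> \<in> Sub C \<Gamma> \<Delta>\<rbrakk> \<Longrightarrow> FSub F \<Gamma> \<Delta> \<gamma> = FSub G \<Gamma> \<Delta> \<gamma>"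
    and ty: "\<And>\<Gamma> A. \<lbrakk>\<Gamma> \<in> Ctx C; A \<in> Ty C \<Gamma>\<rbrakk> \<Longrightarrow> FTy F \<Gamma> A = FTy G \<Gamma> A"
    and tm: "\<And>\<Gamma> A a. \<lbrakk>\<Gamma> \<in> Ctx C; A \<in> Ty C \<Gamma>; a \<in> Tm C \<Gamma> A\<rbrakk> \<Longrightarrow> FTm F \<Gamma> A a = FTm G \<Gamma> A a"
  shows "F = G"
proof (rule cwf_maps.equality)
  interpret F: strict_cwf_morphism C D F by fact
  interpret G: strict_cwf_morphism C D G by fact
  show c: "FCtx F = FCtx G" by (rule PiE_ext[OF F.FCtx_fun G.FCtx_fun ctx])
  show "FSub F = FSub G"
  \<comment> \<open>\<open>PiE_ext\<close> needs both functions in the same product. The codomains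
    for \<open>G\<close> mention \<open>FCtx G\<close>, which \<open>c\<close> replaces by
    \<open>FCtx F\<close>; for \<open>FTm\<close> below, \<open>t\<close> does the same for
    \<open>FTy\<close>.\<close>
  proof (rule PiE_ext[OF F.FSub_fun G.FSub_fun[folded c]])
    fix \<Gamma> assume G: "\<Gamma> \<in> Ctx C"
    show "FSub F \<Gamma> = FSub G \<Gamma>"
    proof (rule PiE_ext[OF PiE_mem[OF F.FSub_fun G] PiE_mem[OF G.FSub_fun[folded c] G]])
      fix \<Delta> assume D: "\<Delta> \<in> Ctx C"
      show "FSub F \<Gamma> \<Delta> = FSub G \<Gamma> \<Delta>"
        by (rule PiE_ext[OF PiE_mem[OF PiE_mem[OF F.FSub_fun G] D]
              PiE_mem[OF PiE_mem[OF G.FSub_fun[folded c] G] D]]) (rule sub[OF G D])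
    qed
  qed
  show t: "FTy F = FTy G"
  proof (rule PiE_ext[OF F.FTy_fun G.FTy_fun[folded c]])
    fix \<Gamma> assume G: "\<Gamma> \<in> Ctx C"
    show "FTy F \<Gamma> = FTy G \<Gamma>"
      by (rule PiE_ext[OF PiE_mem[OF F.FTy_fun G] PiE_mem[OF G.FTy_fun[folded c] G]]) (rule ty[OF G])
  qed
  show "FTm F = FTm G"
  proof (rule PiE_ext[OF F.FTm_fun G.FTm_fun[folded c t]])
    fix \<Gamma> assume G: "\<Gamma> \<in> Ctx C"
    show "FTm F \<Gamma> = FTm G \<Gamma>"
    proof (rule PiE_ext[OF PiE_mem[OF F.FTm_fun G] PiE_mem[OF G.FTm_fun[folded c t] G]])
      fix A assume A: "A \<in> Ty C \<Gamma>"
      show "FTm F \<Gamma> A = FTm G \<Gamma> A"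
        by (rule PiE_ext[OF PiE_mem[OF PiE_mem[OF F.FTm_fun G] A]
              PiE_mem[OF PiE_mem[OF G.FTm_fun[folded c t] G] A]]) (rule tm[OF G A])
    qed
  qed
qed simp

section \<open>Strict morphisms out of \<open>syn_cwf\<close>, read on raw expressions\<close>

locale syn_morphism = strict_cwf_morphism syn_cwf D F
  for D :: "('c, 's, 't, 'm) cwf_data"
    and F :: "(raw_ctx set, raw_sub set, raw_ty set, raw_tm set, 'c, 's, 't, 'm) cwf_maps"
begin

abbreviation ctxF :: "raw_ctx \<Rightarrow> 'c" where
  "ctxF \<Gamma> \<equiv> FCtx F (ctx_class \<Gamma>)"

abbreviation subF :: "raw_ctx \<Rightarrow> raw_ctx \<Rightarrow> raw_sub \<Rightarrow> 's" where
  "subF \<Gamma> \<Delta> \<gamma> \<equiv> FSub F (ctx_class \<Gamma>) (ctx_class \<Delta>) (sub_class \<Gamma> \<Delta> \<gamma>)"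

abbreviation tyF :: "raw_ctx \<Rightarrow> raw_ty \<Rightarrow> 't" where
  "tyF \<Gamma> A \<equiv> FTy F (ctx_class \<Gamma>) (ty_class \<Gamma> A)"

abbreviation tmF :: "raw_ctx \<Rightarrow> raw_ty \<Rightarrow> raw_tm \<Rightarrow> 'm" where
  "tmF \<Gamma> A a \<equiv> FTm F (ctx_class \<Gamma>) (ty_class \<Gamma> A) (tm_class \<Gamma> A a)"

lemma ctxF_in: "eq_ctx \<Gamma> \<Gamma> \<Longrightarrow> ctxF \<Gamma> \<in> Ctx D"
  by (simp add: FCtx_in syn_mem)

lemma subF_in: "eq_sub \<Gamma> \<gamma> \<gamma> \<Delta> \<Longrightarrow> subF \<Gamma> \<Delta> \<gamma> \<in> Sub D (ctxF \<Gamma>) (ctxF \<Delta>)"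
  using FSub_in[OF _ _ syn_mem(2)] presup(2) syn_mem(1) by blast

lemma tyF_in: "eq_ty \<Gamma> A A \<Longrightarrow> tyF \<Gamma> A \<in> Ty D (ctxF \<Gamma>)"
  using FTy_in[OF _ syn_mem(3)] presup(3) syn_mem(1) by blast

lemma ctxF_One: "ctxF rOne = One D"
  using F_One by (simp add: syn_One_class)

lemma ctxF_Ext: "eq_ty \<Gamma> A A \<Longrightarrow> ctxF (rExt \<Gamma> A) = Ext D (ctxF \<Gamma>) (tyF \<Gamma> A)"
  using F_Ext[OF syn_mem(1,3)] presup(3) by (simp add: syn_Ext)

lemma subF_Id: "eq_ctx \<Gamma> \<Gamma> \<Longrightarrow> subF \<Gamma> \<Gamma> (rId \<Gamma>) = Id D (ctxF \<Gamma>)"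
  using F_Id[OF syn_mem(1)] by (simp add: syn_Id)

lemma subF_Comp:
  assumes "eq_sub \<Gamma> \<delta> \<delta> \<Delta>" "eq_sub \<Delta> \<gamma> \<gamma> \<Theta>"
  shows "subF \<Gamma> \<Theta> (rComp \<gamma> \<delta>) = Comp D (ctxF \<Gamma>) (ctxF \<Delta>) (ctxF \<Theta>) (subF \<Delta> \<Theta> \<gamma>) (subF \<Gamma> \<Delta> \<delta>)"
  using F_Comp[OF syn_mem(1,1,1,2,2)] assms presup(2)[OF assms(1)] presup(2)[OF assms(2)]
  by (simp add: syn_Comp)

lemma tyF_TySub:
  assumes "eq_sub \<Gamma> \<gamma> \<gamma> \<Delta>" "eq_ty \<Delta> A A"
  shows "tyF \<Gamma> (rTySub A \<gamma>) = TySub D (ctxF \<Gamma>) (ctxF \<Delta>) (tyF \<Delta> A) (subF \<Gamma> \<Delta> \<gamma>)"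
  using F_TySub[OF syn_mem(1,1,2,3)] assms presup(2)[OF assms(1)] by (simp add: syn_TySub)

lemma tmF_TmSub:
  assumes "eq_sub \<Gamma> \<gamma> \<gamma> \<Delta>" "eq_tm \<Delta> a a A"
  shows "tmF \<Gamma> (rTySub A \<gamma>) (rTmSub a \<gamma>)
    = TmSub D (ctxF \<Gamma>) (ctxF \<Delta>) (tyF \<Delta> A) (tmF \<Delta> A a) (subF \<Gamma> \<Delta> \<gamma>)"
  using F_TmSub[OF syn_mem(1,1,2,3,4)] assms presup(2)[OF assms(1)] presup(4)[OF assms(2)]
  by (simp add: syn_TySub syn_TmSub)

lemma subF_P: "eq_ty \<Gamma> A A \<Longrightarrow> subF (rExt \<Gamma> A) \<Gamma> (rP A) = P D (ctxF \<Gamma>) (tyF \<Gamma> A)"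
  using F_P[OF syn_mem(1,3)] presup(3) by (simp add: syn_Ext syn_P)

lemma tmF_Q:
  "eq_ty \<Gamma> A A \<Longrightarrow> tmF (rExt \<Gamma> A) (rTySub A (rP A)) (rQ A) = Q D (ctxF \<Gamma>) (tyF \<Gamma> A)"
  using F_Q[OF syn_mem(1,3)] presup(3) by (simp add: syn_Ext syn_P syn_Q syn_TySub cong_P)

text \<open>Applying the morphism to the two beta rules shows that the image of a pair has the
  images of \<gamma> and \<open>a\<close> as its components, which determines it by
  \<open>Ext_eqI\<close>.\<close>

lemma
  assumes A: "eq_ty \<Delta> A A" and g: "eq_sub \<Gamma> \<gamma> \<gamma> \<Delta>" and a: "eq_tm \<Gamma> a a (rTySub A \<gamma>)"
  defines "E \<equiv> Ext D (ctxF \<Delta>) (tyF \<Delta> A)" and "p \<equiv> P D (ctxF \<Delta>) (tyF \<Delta> A)"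
    and "q \<equiv> Q D (ctxF \<Delta>) (tyF \<Delta> A)"
  shows P_subF_Pair: "Comp D (ctxF \<Gamma>) E (ctxF \<Delta>) p (subF \<Gamma> (rExt \<Delta> A) (rPair A \<gamma> a)) = subF \<Gamma> \<Delta> \<gamma>"
    and Q_subF_Pair: "TmSub D (ctxF \<Gamma>) E (TySub D E (ctxF \<Delta>) (tyF \<Delta> A) p) q
      (subF \<Gamma> (rExt \<Delta> A) (rPair A \<gamma> a)) = tmF \<Gamma> (rTySub A \<gamma>) a"
proof -
  note pair = cong_Pair[OF A g a] and PA = cong_P[OF A] and QA = cong_Q[OF A]
  note PP = conv_P_Pair[OF A g a]
  have "subF \<Gamma> \<Delta> (rComp (rP A) (rPair A \<gamma> a)) = subF \<Gamma> \<Delta> \<gamma>"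
    by (simp only: sub_class_eq[OF PP])
  then show "Comp D (ctxF \<Gamma>) E (ctxF \<Delta>) p (subF \<Gamma> (rExt \<Delta> A) (rPair A \<gamma> a)) = subF \<Gamma> \<Delta> \<gamma>"
    by (simp add: subF_Comp[OF pair PA] subF_P[OF A] ctxF_Ext[OF A] E_def p_def)
  have e: "eq_ty \<Gamma> (rTySub (rTySub A (rP A)) (rPair A \<gamma> a)) (rTySub A \<gamma>)"
    by (rule eq_ty_TySub_P[OF A pair PP])
  \<comment> \<open>The beta rule holds at type A[\<gamma>], whereas \<open>tmF_TmSub\<close>
    produces the iterated substitution; hence both the type class and the term class are
    rewritten.\<close>
  have "tmF \<Gamma> (rTySub (rTySub A (rP A)) (rPair A \<gamma> a)) (rTmSub (rQ A) (rPair A \<gamma> a))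
      = tmF \<Gamma> (rTySub A \<gamma>) a"
    by (simp only: ty_class_eq[OF e] tm_class_pres[OF presup(3)[OF e] e]
        tm_class_eq[OF conv_Q_Pair[OF A g a]])
  then show "TmSub D (ctxF \<Gamma>) E (TySub D E (ctxF \<Delta>) (tyF \<Delta> A) p) q
      (subF \<Gamma> (rExt \<Delta> A) (rPair A \<gamma> a)) = tmF \<Gamma> (rTySub A \<gamma>) a"
    by (simp add: tmF_TmSub[OF pair QA] tyF_TySub[OF PA A] tmF_Q[OF A] subF_P[OF A] ctxF_Ext[OF A]
        E_def p_def q_def)
qed

end

section \<open>Agreement of two morphisms with the same value on the base type\<close>

locale syn_morphism_pair =
  F: syn_morphism D F + G: syn_morphism D G for D :: "('c, 's, 't, 'm) cwf_data" and F G +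
  assumes base: "FTy F (One syn_cwf) syn_base = FTy G (One syn_cwf) syn_base"
begin

definition agree_ctx :: "raw_ctx \<Rightarrow> bool" where
  "agree_ctx \<Gamma> \<longleftrightarrow> F.ctxF \<Gamma> = G.ctxF \<Gamma>"

text \<open>Agreement on the indices is built in, here and for types and terms, because the
  operations of \<open>D\<close> take the indices as arguments.\<close>

definition agree_sub :: "raw_ctx \<Rightarrow> raw_sub \<Rightarrow> raw_ctx \<Rightarrow> bool" where
  "agree_sub \<Gamma> \<gamma> \<Delta> \<longleftrightarrow> agree_ctx \<Gamma> \<and> agree_ctx \<Delta> \<and> F.subF \<Gamma> \<Delta> \<gamma> = G.subF \<Gamma> \<Delta> \<gamma>"

definition agree_ty :: "raw_ctx \<Rightarrow> raw_ty \<Rightarrow> bool" where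
  "agree_ty \<Gamma> A \<longleftrightarrow> agree_ctx \<Gamma> \<and> F.tyF \<Gamma> A = G.tyF \<Gamma> A"

definition agree_tm :: "raw_ctx \<Rightarrow> raw_tm \<Rightarrow> raw_ty \<Rightarrow> bool" where
  "agree_tm \<Gamma> a A \<longleftrightarrow> agree_ty \<Gamma> A \<and> F.tmF \<Gamma> A a = G.tmF \<Gamma> A a"

lemmas agree_defs = agree_ctx_def agree_sub_def agree_ty_def agree_tm_def

text \<open>The closure lemmas for the constructors assume equations with an arbitrary right-hand
  side, so that they apply directly to the premises of the congruence rules.\<close>

lemma agree_sub_Comp:
  "\<lbrakk>eq_sub \<Gamma> \<delta> \<delta>' \<Delta>; eq_sub \<Delta> \<gamma> \<gamma>' \<Theta>; agree_sub \<Gamma> \<delta> \<Delta>; agree_sub \<Delta> \<gamma> \<Theta>\<rbrakk> \<Longrightarrow> agree_sub \<Gamma> (rComp \<gamma> \<delta>) \<Theta>"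
  using F.subF_Comp[OF refl_left(2,2)] G.subF_Comp[OF refl_left(2,2)] by (simp add: agree_defs)

lemma agree_ty_TySub:
  "\<lbrakk>eq_sub \<Gamma> \<gamma> \<gamma>' \<Delta>; eq_ty \<Delta> A A'; agree_sub \<Gamma> \<gamma> \<Delta>; agree_ty \<Delta> A\<rbrakk> \<Longrightarrow> agree_ty \<Gamma> (rTySub A \<gamma>)"
  using F.tyF_TySub[OF refl_left(2,3)] G.tyF_TySub[OF refl_left(2,3)] by (simp add: agree_defs)

lemma agree_tm_TmSub:
  assumes "eq_sub \<Gamma> \<gamma> \<gamma>' \<Delta>" "eq_tm \<Delta> a a' A" "agree_sub \<Gamma> \<gamma> \<Delta>" "agree_tm \<Delta> a A"
  shows "agree_tm \<Gamma> (rTmSub a \<gamma>) (rTySub A \<gamma>)"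
proof -
  have "agree_ty \<Gamma> (rTySub A \<gamma>)"
    using assms presup(4) by (intro agree_ty_TySub[OF assms(1)]) (auto simp: agree_tm_def)
  then show ?thesis
    using assms F.tmF_TmSub[OF refl_left(2,4), OF assms(1,2)] G.tmF_TmSub[OF refl_left(2,4), OF assms(1,2)]
    by (simp add: agree_defs)
qed

lemma agree_ctx_Ext: "eq_ty \<Gamma> A A' \<Longrightarrow> agree_ty \<Gamma> A \<Longrightarrow> agree_ctx (rExt \<Gamma> A)"
  using F.ctxF_Ext[OF refl_left(3)] G.ctxF_Ext[OF refl_left(3)] by (simp add: agree_defs)

lemma agree_sub_P: "eq_ty \<Gamma> A A' \<Longrightarrow> agree_ty \<Gamma> A \<Longrightarrow> agree_sub (rExt \<Gamma> A) (rP A) \<Gamma>"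
  using F.subF_P[OF refl_left(3)] G.subF_P[OF refl_left(3)] agree_ctx_Ext by (simp add: agree_defs)

lemma agree_tm_Q:
  assumes "eq_ty \<Gamma> A A'" "agree_ty \<Gamma> A"
  shows "agree_tm (rExt \<Gamma> A) (rQ A) (rTySub A (rP A))"
proof -
  have "agree_ty (rExt \<Gamma> A) (rTySub A (rP A))"
    using assms agree_sub_P by (intro agree_ty_TySub[OF cong_P]) auto
  then show ?thesis
    using assms F.tmF_Q[OF refl_left(3)] G.tmF_Q[OF refl_left(3)] by (simp add: agree_defs)
qed

text \<open>No preservation axiom mentions the substitution into \<open>1\<close>; its two images
  agree because both are maps from one context into the terminal object of \<open>D\<close>.\<close>

lemma agree_sub_Bang:
  assumes "eq_ctx \<Gamma> \<Gamma>'" "agree_ctx \<Gamma>"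
  shows "agree_sub \<Gamma> (rBang \<Gamma>) rOne"
proof -
  have b: "eq_sub \<Gamma> (rBang \<Gamma>) (rBang \<Gamma>) rOne"
    using cong_Bang[OF refl_left(1)[OF assms(1)]] .
  show ?thesis
    using F.subF_in[OF b] G.subF_in[OF b] F.D.One_terminal[OF F.ctxF_in[OF refl_left(1)[OF assms(1)]]] assms
    by (auto simp: agree_defs F.ctxF_One G.ctxF_One)
qed

text \<open>The two images have the same components by \<open>P_subF_Pair\<close> and
  \<open>Q_subF_Pair\<close>, so joint monicity of the projections in \<open>D\<close> identifies
  them.\<close>

lemma agree_sub_Pair:
  assumes "eq_ty \<Gamma> A A'" "eq_sub \<Delta> \<gamma> \<gamma>' \<Gamma>" "eq_tm \<Delta> a a' (rTySub A \<gamma>)"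
    and "agree_ty \<Gamma> A" "agree_sub \<Delta> \<gamma> \<Gamma>" "agree_tm \<Delta> a (rTySub A \<gamma>)"
  shows "agree_sub \<Delta> (rPair A \<gamma> a) (rExt \<Gamma> A)"
proof -
  note h = refl_left(3)[OF assms(1)] refl_left(2)[OF assms(2)] refl_left(4)[OF assms(3)]
  note b = cong_Pair[OF h]
  \<comment> \<open>Orienting the agreements from \<open>F\<close> to \<open>G\<close> places both
    images in a single hom-set.\<close>
  have [simp]: "F.ctxF \<Gamma> = G.ctxF \<Gamma>" "F.ctxF \<Delta> = G.ctxF \<Delta>" "F.tyF \<Gamma> A = G.tyF \<Gamma> A"
    "F.ctxF (rExt \<Gamma> A) = G.ctxF (rExt \<Gamma> A)"
    "F.subF \<Delta> \<Gamma> \<gamma> = G.subF \<Delta> \<Gamma> \<gamma>" "F.tmF \<Delta> (rTySub A \<gamma>) a = G.tmF \<Delta> (rTySub A \<gamma>) a"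
    using assms agree_ctx_Ext by (auto simp: agree_defs)
  have "F.subF \<Delta> (rExt \<Gamma> A) (rPair A \<gamma> a) = G.subF \<Delta> (rExt \<Gamma> A) (rPair A \<gamma> a)"
  proof (rule F.D.Ext_eqI)
    show "G.ctxF \<Delta> \<in> Ctx D" "G.ctxF \<Gamma> \<in> Ctx D" "G.tyF \<Gamma> A \<in> Ty D (G.ctxF \<Gamma>)"
      using presup(2)[OF h(2)] h(1) by (auto intro: G.ctxF_in G.tyF_in)
    show "F.subF \<Delta> (rExt \<Gamma> A) (rPair A \<gamma> a) \<in> Sub D (G.ctxF \<Delta>) (Ext D (G.ctxF \<Gamma>) (G.tyF \<Gamma> A))"
      "G.subF \<Delta> (rExt \<Gamma> A) (rPair A \<gamma> a) \<in> Sub D (G.ctxF \<Delta>) (Ext D (G.ctxF \<Gamma>) (G.tyF \<Gamma> A))"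
      using F.subF_in[OF b] G.subF_in[OF b] by (simp_all add: G.ctxF_Ext[OF h(1)])
  qed (use F.P_subF_Pair[OF h] G.P_subF_Pair[OF h] F.Q_subF_Pair[OF h] G.Q_subF_Pair[OF h] in simp_all)
  then show ?thesis
    using assms agree_ctx_Ext by (simp add: agree_sub_def agree_ty_def)
qed

text \<open>
  It suffices to treat the left-hand side of each judgment: both sides have the same equivalence
  class, so at every rule the more convenient side may be chosen.
\<close>

lemma agreement:
  "eq_ctx \<Gamma> \<Gamma>' \<Longrightarrow> agree_ctx \<Gamma>"
  "eq_sub \<Gamma> \<gamma> \<gamma>' \<Delta> \<Longrightarrow> agree_sub \<Gamma> \<gamma> \<Delta>"
  "eq_ty \<Gamma> A A' \<Longrightarrow> agree_ty \<Gamma> A"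
  "eq_tm \<Gamma> a a' A \<Longrightarrow> agree_tm \<Gamma> a A"
proof (induction rule: eq_ctx_eq_sub_eq_ty_eq_tm.inducts)
  case (ctx_sym \<Gamma> \<Gamma>') then show ?case
    by (simp add: agree_ctx_def ctx_class_eq[OF ctx_sym(1)])
next
  case (sub_sym \<Delta> \<gamma> \<gamma>' \<Gamma>) then show ?case
    by (simp add: agree_sub_def sub_class_eq[OF sub_sym(1)])
next
  case (ty_sym \<Gamma> A A') then show ?case by (simp add: agree_ty_def ty_class_eq[OF ty_sym(1)])
next
  case (tm_sym \<Gamma> a a' A) then show ?case
    by (simp add: agree_tm_def tm_class_eq[OF tm_sym(1)])
next
  case (sub_pres \<Gamma> \<Gamma>' \<Delta> \<Delta>' \<gamma> \<gamma>')
  then show ?case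
    by (simp add: agree_sub_def agree_ctx_def sub_class_pres[OF sub_pres(1,2)] ctx_class_eq[OF sub_pres(1)]
        ctx_class_eq[OF sub_pres(2)])
next
  case (ty_pres \<Gamma> \<Gamma>' A A')
  then show ?case
    by (simp add: agree_ty_def agree_ctx_def ty_class_pres[OF ty_pres(1)] ctx_class_eq[OF ty_pres(1)])
next
  case (tm_pres \<Gamma> \<Gamma>' A A' a a')
  have "ty_class \<Gamma> A = ty_class \<Gamma>' A'"
    using ty_class_pres[OF tm_pres(1)] ty_class_eq[OF tm_pres(2)] by simp
  then show ?case
    using tm_pres
    by (simp add: agree_tm_def agree_ty_def agree_ctx_def tm_class_pres[OF tm_pres(1,2)] ctx_class_eq[OF tm_pres(1)])
next
  case cong_One then show ?case by (simp add: agree_ctx_def F.ctxF_One G.ctxF_One)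
next
  \<comment> \<open>The only case that uses the common value on the base type.\<close>
  case cong_Base then show ?case
    using base
      by (simp add: agree_ty_def agree_ctx_def F.ctxF_One G.ctxF_One syn_base_def syn_One_def syn_One_class)
next
  case (cong_Id \<Gamma> \<Gamma>') then show ?case
    using refl_left(1)[OF cong_Id(1)] by (simp add: agree_sub_def agree_ctx_def F.subF_Id G.subF_Id)
next
  case (conv_TySub_Comp \<Theta> A \<Delta> \<gamma> \<Gamma> \<delta>)
  then show ?case by (blast intro: agree_ty_TySub agree_sub_Comp cong_Comp)
next
  case (conv_TmSub_Comp \<Theta> a A \<Delta> \<gamma> \<Gamma> \<delta>)
  then show ?case by (blast intro: agree_tm_TmSub agree_sub_Comp cong_Comp)
next
  case (conv_TySub_Id \<Gamma> A)
  then show ?case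
    by (simp add: agree_ty_def ty_class_eq[OF eq_ctx_eq_sub_eq_ty_eq_tm.conv_TySub_Id[OF conv_TySub_Id(1)]])
next
  case (conv_TmSub_Id \<Gamma> a A)
  then show ?case
    by (simp add: agree_tm_def tm_class_eq[OF eq_ctx_eq_sub_eq_ty_eq_tm.conv_TmSub_Id[OF conv_TmSub_Id(1)]])
next
  case (conv_assoc \<Gamma> \<gamma> \<Delta> \<delta> \<Theta> \<theta> \<Xi>)
  then show ?case by (blast intro: agree_sub_Comp cong_Comp)
next
  case (conv_P_Pair \<Gamma> A \<Delta> \<gamma> a)
  then show ?case
    by (simp add: agree_sub_def sub_class_eq[OF eq_ctx_eq_sub_eq_ty_eq_tm.conv_P_Pair[OF conv_P_Pair(1-3)]])
next
  case (conv_Q_Pair \<Gamma> A \<Delta> \<gamma> a)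
  then show ?case
    by (simp add: agree_tm_def tm_class_eq[OF eq_ctx_eq_sub_eq_ty_eq_tm.conv_Q_Pair[OF conv_Q_Pair(1-3)]])
\<comment> \<open>Transitivity and the conversion rules whose left-hand side is that of a premise
  close by assumption; the remaining congruence rules are the closure lemmas.\<close>
qed (assumption | rule agree_ctx_Ext agree_ty_TySub agree_sub_Bang agree_sub_Comp agree_sub_P
    agree_tm_Q agree_sub_Pair agree_tm_TmSub)+

lemma morphisms_eq: "F = G"
proof (rule strict_cwf_morphism_eqI)
  show "strict_cwf_morphism syn_cwf D F" "strict_cwf_morphism syn_cwf D G" by unfold_locales
qed (auto elim!: syn_CtxE syn_SubE syn_TyE syn_TmE dest: agreement simp: agree_defs)

end

section \<open>Existence\<close>

context cwf
begin

text \<open>The record of a cwf has no fields for the empty substitution and for pairing; definite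
  description extracts them from unique existence, so that the raw constructors have something to
  denote.\<close>

definition bang :: "'c \<Rightarrow> 's" where
  "bang \<Gamma> = (THE \<gamma>. \<gamma> \<in> Sub C \<Gamma> (One C))"

definition pair :: "'c \<Rightarrow> 'c \<Rightarrow> 't \<Rightarrow> 's \<Rightarrow> 'm \<Rightarrow> 's" where
  "pair \<Gamma> \<Delta> A \<gamma> a = (THE \<theta>. \<theta> \<in> Sub C \<Gamma> (Ext C \<Delta> A)
    \<and> Comp C \<Gamma> (Ext C \<Delta> A) \<Delta> (P C \<Delta> A) \<theta> = \<gamma>
    \<and> TmSub C \<Gamma> (Ext C \<Delta> A) (TySub C (Ext C \<Delta> A) \<Delta> A (P C \<Delta> A)) (Q C \<Delta> A) \<theta> = a)"

lemma bang_closed: "\<Gamma> \<in> Ctx C \<Longrightarrow> bang \<Gamma> \<in> Sub C \<Gamma> (One C)"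
  unfolding bang_def by (rule theI'[OF One_terminal])

lemma bang_unique: "\<Gamma> \<in> Ctx C \<Longrightarrow> \<gamma> \<in> Sub C \<Gamma> (One C) \<Longrightarrow> bang \<Gamma> = \<gamma>"
  using bang_closed One_terminal by blast

lemma
  assumes "\<Gamma> \<in> Ctx C" "\<Delta> \<in> Ctx C" "A \<in> Ty C \<Delta>" "\<gamma> \<in> Sub C \<Gamma> \<Delta>" "a \<in> Tm C \<Gamma> (TySub C \<Gamma> \<Delta> A \<gamma>)"
  shows pair_closed: "pair \<Gamma> \<Delta> A \<gamma> a \<in> Sub C \<Gamma> (Ext C \<Delta> A)"
    and P_pair: "Comp C \<Gamma> (Ext C \<Delta> A) \<Delta> (P C \<Delta> A) (pair \<Gamma> \<Delta> A \<gamma> a) = \<gamma>"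
    and Q_pair: "TmSub C \<Gamma> (Ext C \<Delta> A) (TySub C (Ext C \<Delta> A) \<Delta> A (P C \<Delta> A)) (Q C \<Delta> A)
      (pair \<Gamma> \<Delta> A \<gamma> a) = a"
  using theI'[OF Ext_universal[OF assms], folded pair_def] by auto

lemma TySub_P:
  "\<lbrakk>\<Gamma> \<in> Ctx C; \<Delta> \<in> Ctx C; A \<in> Ty C \<Delta>; \<theta> \<in> Sub C \<Gamma> (Ext C \<Delta> A)\<rbrakk>
    \<Longrightarrow> TySub C \<Gamma> (Ext C \<Delta> A) (TySub C (Ext C \<Delta> A) \<Delta> A (P C \<Delta> A)) \<theta>
      = TySub C \<Gamma> \<Delta> A (Comp C \<Gamma> (Ext C \<Delta> A) \<Delta> (P C \<Delta> A) \<theta>)"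
  by (rule TySub_Comp[symmetric]) (auto intro: Ext_closed P_closed)

text \<open>With its type rewritten to A[p \<circ> \<theta>], the term q[\<theta>] is admissible as
  the second component of a pair.\<close>

lemma TmSub_Q_closed:
  assumes "\<Gamma> \<in> Ctx C" "\<Delta> \<in> Ctx C" "A \<in> Ty C \<Delta>" "\<theta> \<in> Sub C \<Gamma> (Ext C \<Delta> A)"
  shows "TmSub C \<Gamma> (Ext C \<Delta> A) (TySub C (Ext C \<Delta> A) \<Delta> A (P C \<Delta> A)) (Q C \<Delta> A) \<theta>
      \<in> Tm C \<Gamma> (TySub C \<Gamma> \<Delta> A (Comp C \<Gamma> (Ext C \<Delta> A) \<Delta> (P C \<Delta> A) \<theta>))"
  unfolding TySub_P[OF assms, symmetric]
  using assms by (intro TmSub_closed TySub_closed Q_closed Ext_closed P_closed) auto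

text \<open>Both sides have the same two projections, so \<open>Ext_eqI\<close> applies.\<close>

lemma pair_eta:
  assumes "\<Gamma> \<in> Ctx C" "\<Delta> \<in> Ctx C" "A \<in> Ty C \<Delta>" "\<theta> \<in> Sub C \<Gamma> (Ext C \<Delta> A)"
  shows "pair \<Gamma> \<Delta> A (Comp C \<Gamma> (Ext C \<Delta> A) \<Delta> (P C \<Delta> A) \<theta>)
      (TmSub C \<Gamma> (Ext C \<Delta> A) (TySub C (Ext C \<Delta> A) \<Delta> A (P C \<Delta> A)) (Q C \<Delta> A) \<theta>) = \<theta>"
proof -
  have "Comp C \<Gamma> (Ext C \<Delta> A) \<Delta> (P C \<Delta> A) \<theta> \<in> Sub C \<Gamma> \<Delta>"
    using assms by (intro Comp_closed[of _ "Ext C \<Delta> A"] Ext_closed P_closed) auto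
  note h = assms(1-3) this TmSub_Q_closed[OF assms]
  show ?thesis
    by (rule Ext_eqI[OF assms(1-3) pair_closed[OF h] assms(4) P_pair[OF h] Q_pair[OF h]])
qed

end

section \<open>Interpretation of raw syntax and its soundness\<close>

locale cwf_base = cwf C for C :: "('c, 's, 't, 'm) cwf_data" +
  fixes oC :: 't
  assumes oC_closed: "oC \<in> Ty C (One C)"
begin

text \<open>The values on ill-formed expressions are meaningless.\<close>

primrec ictx :: "raw_ctx \<Rightarrow> 'c" and isub :: "raw_sub \<Rightarrow> 'c \<times> 'c \<times> 's"
  and ity :: "raw_ty \<Rightarrow> 'c \<times> 't" and itm :: "raw_tm \<Rightarrow> 'c \<times> 't \<times> 'm"
where
  "ictx rOne = One C"
| "ictx (rExt \<Gamma> A) = Ext C (ictx \<Gamma>) (snd (ity A))"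
| "isub (rComp \<gamma> \<delta>) =
    (case isub \<delta> of (X, Y, d) \<Rightarrow> case isub \<gamma> of (_, Z, g) \<Rightarrow> (X, Z, Comp C X Y Z g d))"
| "isub (rId \<Gamma>) = (ictx \<Gamma>, ictx \<Gamma>, Id C (ictx \<Gamma>))"
| "isub (rBang \<Gamma>) = (ictx \<Gamma>, One C, bang (ictx \<Gamma>))"
| "isub (rP A) = (case ity A of (X, K) \<Rightarrow> (Ext C X K, X, P C X K))"
| "isub (rPair A \<gamma> a) =
    (case isub \<gamma> of (X, Y, g) \<Rightarrow> case ity A of (_, K) \<Rightarrow> case itm a of (_, _, t) \<Rightarrow>
      (X, Ext C Y K, pair X Y K g t))"
| "ity rBase = (One C, oC)"
| "ity (rTySub A \<gamma>) = (case isub \<gamma> of (X, Y, g) \<Rightarrow> case ity A of (_, K) \<Rightarrow> (X, TySub C X Y K g))"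
| "itm (rTmSub a \<gamma>) = (case isub \<gamma> of (X, Y, g) \<Rightarrow> case itm a of (_, K, t) \<Rightarrow>
    (X, TySub C X Y K g, TmSub C X Y K t g))"
| "itm (rQ A) = (case ity A of (X, K) \<Rightarrow>
    (Ext C X K, TySub C (Ext C X K) X K (P C X K), Q C X K))"

definition ok_ty :: "raw_ctx \<Rightarrow> raw_ty \<Rightarrow> bool" where
  "ok_ty \<Gamma> A \<longleftrightarrow> (\<exists>K\<in>Ty C (ictx \<Gamma>). ity A = (ictx \<Gamma>, K))"

definition ok_sub :: "raw_ctx \<Rightarrow> raw_sub \<Rightarrow> raw_ctx \<Rightarrow> bool" where
  "ok_sub \<Gamma> \<gamma> \<Delta> \<longleftrightarrow> (\<exists>g\<in>Sub C (ictx \<Gamma>) (ictx \<Delta>). isub \<gamma> = (ictx \<Gamma>, ictx \<Delta>, g))"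

definition ok_tm :: "raw_ctx \<Rightarrow> raw_tm \<Rightarrow> raw_ty \<Rightarrow> bool" where
  "ok_tm \<Gamma> a A \<longleftrightarrow> (\<exists>K\<in>Ty C (ictx \<Gamma>). \<exists>t\<in>Tm C (ictx \<Gamma>) K.
    ity A = (ictx \<Gamma>, K) \<and> itm a = (ictx \<Gamma>, K, t))"

text \<open>Hereditary, and not merely membership of \<open>ictx \<Gamma>\<close> in
  \<open>Ctx C\<close>: the eta rule has only a substitution into \<open>rExt \<Gamma> A\<close> as
  premise, so the typing of \<open>A\<close> must be recoverable from the extended context.\<close>

fun ok_ctx :: "raw_ctx \<Rightarrow> bool" where
  "ok_ctx rOne = True"
| "ok_ctx (rExt \<Gamma> A) = (ok_ctx \<Gamma> \<and> ok_ty \<Gamma> A)"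

lemma ictx_closed: "ok_ctx \<Gamma> \<Longrightarrow> ictx \<Gamma> \<in> Ctx C"
  by (induction \<Gamma> rule: ok_ctx.induct) (auto simp: ok_ty_def One_closed Ext_closed)

lemmas ok_defs = ok_ty_def ok_sub_def ok_tm_def
lemmas closed = ictx_closed Id_closed Comp_closed TySub_closed TmSub_closed One_closed Ext_closed
  P_closed Q_closed bang_closed pair_closed oC_closed TmSub_Q_closed

text \<open>Conversion rules become laws of \<open>C\<close>, whose hypotheses the typing conjuncts
  supply. Contexts carry \<open>ok_ctx\<close> for both sides because it is not a function of
  \<open>ictx\<close>; elsewhere the right-hand side inherits its typing from the equal
  interpretation.\<close>

lemma soundness:
  "eq_ctx \<Gamma> \<Gamma>' \<Longrightarrow> ok_ctx \<Gamma> \<and> ok_ctx \<Gamma>' \<and> ictx \<Gamma>' = ictx \<Gamma>"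
  "eq_sub \<Gamma> \<gamma> \<gamma>' \<Delta> \<Longrightarrow> ok_ctx \<Gamma> \<and> ok_ctx \<Delta> \<and> ok_sub \<Gamma> \<gamma> \<Delta> \<and> isub \<gamma>' = isub \<gamma>"
  "eq_ty \<Gamma> A A' \<Longrightarrow> ok_ctx \<Gamma> \<and> ok_ty \<Gamma> A \<and> ity A' = ity A"
  "eq_tm \<Gamma> a a' A \<Longrightarrow> ok_ctx \<Gamma> \<and> ok_tm \<Gamma> a A \<and> itm a' = itm a"
proof (induction rule: eq_ctx_eq_sub_eq_ty_eq_tm.inducts)
  case conv_assoc then show ?case by (auto simp: ok_defs closed Comp_assoc)
next
  case conv_TySub_Comp then show ?case by (auto simp: ok_defs closed TySub_Comp)
next
  case conv_TmSub_Comp then show ?case by (auto simp: ok_defs closed TySub_Comp TmSub_Comp)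
next
  case conv_P_Pair then show ?case by (auto simp: ok_defs closed P_pair)
next
  case conv_Q_Pair then show ?case by (auto simp: ok_defs closed P_pair Q_pair TySub_P)
next
  case conv_Pair_eta then show ?case by (auto simp: ok_defs closed pair_eta)
next
  case cong_Bang then show ?case using bang_closed[OF ictx_closed] by (auto simp: ok_defs)
qed (auto simp: ok_defs closed Id_Comp Comp_Id TySub_Id TmSub_Id bang_unique)

section \<open>The strict morphism induced on equivalence classes\<close>

text \<open>By \<open>soundness\<close> the value does not depend on the representative picked by
  \<open>SOME\<close>. The restricted abstractions make the components extensional.\<close>

definition interp ::
  "(raw_ctx set, raw_sub set, raw_ty set, raw_tm set, 'c, 's, 't, 'm) cwf_maps" where
  "interp =
    \<lparr> FCtx = (\<lambda>X\<in>Ctx syn_cwf. ictx (SOME \<Gamma>. \<Gamma> \<in> X)),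
      FSub = (\<lambda>X\<in>Ctx syn_cwf. \<lambda>Y\<in>Ctx syn_cwf. \<lambda>g\<in>Sub syn_cwf X Y.
        snd (snd (isub (SOME \<gamma>. \<gamma> \<in> g)))),
      FTy = (\<lambda>X\<in>Ctx syn_cwf. \<lambda>K\<in>Ty syn_cwf X. snd (ity (SOME A. A \<in> K))),
      FTm = (\<lambda>X\<in>Ctx syn_cwf. \<lambda>K\<in>Ty syn_cwf X. \<lambda>t\<in>Tm syn_cwf X K.
        snd (snd (itm (SOME a. a \<in> t)))) \<rparr>"

lemma interp_Ctx:
  assumes "eq_ctx \<Gamma> \<Gamma>"
  shows "FCtx interp (ctx_class \<Gamma>) = ictx \<Gamma>"
proof -
  have "ictx (SOME \<Gamma>'. eq_ctx \<Gamma> \<Gamma>') = ictx \<Gamma>"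
    using soundness(1)[OF someI[of "eq_ctx \<Gamma>", OF assms]] by blast
  then show ?thesis using assms by (simp add: interp_def syn_mem)
qed

lemma interp_Sub:
  assumes "eq_sub \<Gamma> \<gamma> \<gamma> \<Delta>"
  shows "FSub interp (ctx_class \<Gamma>) (ctx_class \<Delta>) (sub_class \<Gamma> \<Delta> \<gamma>) = snd (snd (isub \<gamma>))"
proof -
  have "isub (SOME \<gamma>'. eq_sub \<Gamma> \<gamma> \<gamma>' \<Delta>) = isub \<gamma>"
    using soundness(2)[OF someI[of "\<lambda>\<gamma>'. eq_sub \<Gamma> \<gamma> \<gamma>' \<Delta>", OF assms]] by blast
  then show ?thesis using assms presup(2)[OF assms] by (simp add: interp_def syn_mem)
qed

lemma interp_Ty:
  assumes "eq_ty \<Gamma> A A"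
  shows "FTy interp (ctx_class \<Gamma>) (ty_class \<Gamma> A) = snd (ity A)"
proof -
  have "ity (SOME A'. eq_ty \<Gamma> A A') = ity A"
    using soundness(3)[OF someI[of "eq_ty \<Gamma> A", OF assms]] by blast
  then show ?thesis using assms presup(3)[OF assms] by (simp add: interp_def syn_mem)
qed

lemma interp_Tm:
  assumes "eq_tm \<Gamma> a a A"
  shows "FTm interp (ctx_class \<Gamma>) (ty_class \<Gamma> A) (tm_class \<Gamma> A a) = snd (snd (itm a))"
proof -
  have "itm (SOME a'. eq_tm \<Gamma> a a' A) = itm a"
    using soundness(4)[OF someI[of "\<lambda>a'. eq_tm \<Gamma> a a' A", OF assms]] by blast
  then show ?thesis using assms presup(4)[OF assms] by (simp add: interp_def syn_mem)
qed

lemma interp_extensional: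
  "FCtx interp \<in> extensional (Ctx syn_cwf)"
  "FSub interp \<in> extensional (Ctx syn_cwf)"
  "X \<in> Ctx syn_cwf \<Longrightarrow> FSub interp X \<in> extensional (Ctx syn_cwf)"
  "X \<in> Ctx syn_cwf \<Longrightarrow> Y \<in> Ctx syn_cwf \<Longrightarrow> FSub interp X Y \<in> extensional (Sub syn_cwf X Y)"
  "FTy interp \<in> extensional (Ctx syn_cwf)"
  "X \<in> Ctx syn_cwf \<Longrightarrow> FTy interp X \<in> extensional (Ty syn_cwf X)"
  "FTm interp \<in> extensional (Ctx syn_cwf)"
  "X \<in> Ctx syn_cwf \<Longrightarrow> FTm interp X \<in> extensional (Ty syn_cwf X)"
  "X \<in> Ctx syn_cwf \<Longrightarrow> K \<in> Ty syn_cwf X \<Longrightarrow> FTm interp X K \<in> extensional (Tm syn_cwf X K)"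
  by (simp_all add: interp_def)

lemmas interp = interp_Ctx interp_Sub interp_Ty interp_Tm

lemma isubE:
  assumes "eq_sub \<Gamma> \<gamma> \<gamma> \<Delta>"
  obtains g where "isub \<gamma> = (ictx \<Gamma>, ictx \<Delta>, g)" "g \<in> Sub C (ictx \<Gamma>) (ictx \<Delta>)"
  using soundness(2)[OF assms] by (auto simp: ok_defs)

lemma ityE:
  assumes "eq_ty \<Gamma> A A"
  obtains K where "ity A = (ictx \<Gamma>, K)" "K \<in> Ty C (ictx \<Gamma>)"
  using soundness(3)[OF assms] by (auto simp: ok_defs)

lemma itmE:
  assumes "eq_tm \<Gamma> a a A"
  obtains K t where "ity A = (ictx \<Gamma>, K)" "itm a = (ictx \<Gamma>, K, t)" "t \<in> Tm C (ictx \<Gamma>) K"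
  using soundness(4)[OF assms] by (auto simp: ok_defs)

text \<open>Typing comes from \<open>soundness\<close>. For preservation, both sides are evaluated
  on representatives, where the recursive equations of the interpretation match the operations of
  \<open>C\<close>.\<close>

lemma interp_morphism: "strict_cwf_morphism syn_cwf C interp"
proof (intro strict_cwf_morphism.intro strict_cwf_morphism_axioms.intro, goal_cases)
  case 1 show ?case by (rule cwf_syn)
next
  case 2 show ?case by (rule cwf_axioms)
next
  case 3
  have "FCtx interp X \<in> Ctx C" if "X \<in> Ctx syn_cwf" for X
    using that
      by (auto simp: interp elim!: syn_CtxE dest: soundness(1)[THEN conjunct1, THEN ictx_closed])
  then show ?case by (simp add: PiE_iff interp_extensional)
next
  case 4
  have "FSub interp X Y g \<in> Sub C (FCtx interp X) (FCtx interp Y)"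
    if XY: "X \<in> Ctx syn_cwf" "Y \<in> Ctx syn_cwf" and g: "g \<in> Sub syn_cwf X Y" for X Y g
  proof -
    obtain \<Gamma> \<Delta> where G: "X = ctx_class \<Gamma>" "eq_ctx \<Gamma> \<Gamma>" "Y = ctx_class \<Delta>" "eq_ctx \<Delta> \<Delta>"
      using XY by (auto elim!: syn_CtxE)
    obtain \<gamma> where g: "g = sub_class \<Gamma> \<Delta> \<gamma>" "eq_sub \<Gamma> \<gamma> \<gamma> \<Delta>"
      using g unfolding G by (rule syn_SubE)
    obtain s where "isub \<gamma> = (ictx \<Gamma>, ictx \<Delta>, s)" "s \<in> Sub C (ictx \<Gamma>) (ictx \<Delta>)"
      using isubE[OF g(2)] .
    then show ?thesis by (simp add: G g interp)
  qed
  then show ?case by (simp add: PiE_iff interp_extensional)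
next
  case 5
  have "FTy interp X K \<in> Ty C (FCtx interp X)"
    if X: "X \<in> Ctx syn_cwf" and K: "K \<in> Ty syn_cwf X" for X K
  proof -
    obtain \<Gamma> where G: "X = ctx_class \<Gamma>" "eq_ctx \<Gamma> \<Gamma>"
      using X by (rule syn_CtxE)
    obtain A where A: "K = ty_class \<Gamma> A" "eq_ty \<Gamma> A A"
      using K unfolding G by (rule syn_TyE)
    obtain K' where "ity A = (ictx \<Gamma>, K')" "K' \<in> Ty C (ictx \<Gamma>)"
      using ityE[OF A(2)] .
    then show ?thesis by (simp add: G A interp)
  qed
  then show ?case by (simp add: PiE_iff interp_extensional)
next
  case 6
  have "FTm interp X K t \<in> Tm C (FCtx interp X) (FTy interp X K)"
    if X: "X \<in> Ctx syn_cwf" and K: "K \<in> Ty syn_cwf X" and t: "t \<in> Tm syn_cwf X K" for X K t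
  proof -
    obtain \<Gamma> where G: "X = ctx_class \<Gamma>" "eq_ctx \<Gamma> \<Gamma>"
      using X by (rule syn_CtxE)
    obtain A where A: "K = ty_class \<Gamma> A" "eq_ty \<Gamma> A A"
      using K unfolding G by (rule syn_TyE)
    obtain a where a: "t = tm_class \<Gamma> A a" "eq_tm \<Gamma> a a A"
      using t unfolding G A by (rule syn_TmE)
    obtain K' t' where "ity A = (ictx \<Gamma>, K')" "itm a = (ictx \<Gamma>, K', t')" "t' \<in> Tm C (ictx \<Gamma>) K'"
      using itmE[OF a(2)] .
    then show ?thesis by (simp add: G A a interp)
  qed
  then show ?case by (simp add: PiE_iff interp_extensional)
next
  case (7 X) then show ?case
    by (auto elim!: syn_CtxE simp: syn_Id interp cong_Id)
next
  case (8 X Y Z d g)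
  then obtain \<Gamma> \<Delta> \<Theta> \<delta> \<gamma> where [simp]: "X = ctx_class \<Gamma>" "Y = ctx_class \<Delta>" "Z = ctx_class \<Theta>"
    "d = sub_class \<Gamma> \<Delta> \<delta>" "g = sub_class \<Delta> \<Theta> \<gamma>"
    and h: "eq_ctx \<Gamma> \<Gamma>" "eq_ctx \<Delta> \<Delta>" "eq_ctx \<Theta> \<Theta>" "eq_sub \<Gamma> \<delta> \<delta> \<Delta>" "eq_sub \<Delta> \<gamma> \<gamma> \<Theta>"
    by (auto elim!: syn_CtxE syn_SubE)
  \<comment> \<open>The interpretation of a composite uses the indices returned for its parts; this
    identifies them with the interpreted contexts.\<close>
  obtain d' g' where "isub \<delta> = (ictx \<Gamma>, ictx \<Delta>, d')" "isub \<gamma> = (ictx \<Delta>, ictx \<Theta>, g')"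
    using isubE[OF h(4)] isubE[OF h(5)] by metis
  then show ?case using h by (simp add: syn_Comp interp cong_Comp)
next
  case (9 X Y g K)
  then obtain \<Gamma> \<Delta> \<gamma> A where [simp]: "X = ctx_class \<Gamma>" "Y = ctx_class \<Delta>"
    "g = sub_class \<Gamma> \<Delta> \<gamma>" "K = ty_class \<Delta> A"
    and h: "eq_ctx \<Gamma> \<Gamma>" "eq_ctx \<Delta> \<Delta>" "eq_sub \<Gamma> \<gamma> \<gamma> \<Delta>" "eq_ty \<Delta> A A"
    by (auto elim!: syn_CtxE syn_SubE syn_TyE)
  obtain g' K' where "isub \<gamma> = (ictx \<Gamma>, ictx \<Delta>, g')" "ity A = (ictx \<Delta>, K')"
    using isubE[OF h(3)] ityE[OF h(4)] by metis
  then show ?case using h by (simp add: syn_TySub interp cong_TySub)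
next
  case (10 X Y g K t)
  then obtain \<Gamma> \<Delta> \<gamma> A a where [simp]: "X = ctx_class \<Gamma>" "Y = ctx_class \<Delta>"
    "g = sub_class \<Gamma> \<Delta> \<gamma>" "K = ty_class \<Delta> A" "t = tm_class \<Delta> A a"
    and h: "eq_ctx \<Gamma> \<Gamma>" "eq_ctx \<Delta> \<Delta>" "eq_sub \<Gamma> \<gamma> \<gamma> \<Delta>" "eq_ty \<Delta> A A" "eq_tm \<Delta> a a A"
    by (auto elim!: syn_CtxE syn_SubE syn_TyE syn_TmE)
  \<comment> \<open>The type index stored with \<open>a\<close> must be the interpretation of
    \<open>A\<close> itself, which \<open>itmE\<close> provides through the shared
    \<open>K'\<close>.\<close>
  obtain g' K' t' where "isub \<gamma> = (ictx \<Gamma>, ictx \<Delta>, g')" "ity A = (ictx \<Delta>, K')"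
    "itm a = (ictx \<Delta>, K', t')"
    using isubE[OF h(3)] itmE[OF h(5)] by metis
  then show ?case using h by (simp add: syn_TySub syn_TmSub interp cong_TmSub cong_TySub)
next
  case 11 show ?case by (simp add: syn_One_class interp cong_One)
next
  case (12 X K)
  then obtain \<Gamma> A where [simp]: "X = ctx_class \<Gamma>" "K = ty_class \<Gamma> A"
    and h: "eq_ctx \<Gamma> \<Gamma>" "eq_ty \<Gamma> A A"
    by (auto elim!: syn_CtxE syn_TyE)
  show ?case using h by (simp add: syn_Ext interp cong_Ext)
next
  case (13 X K)
  then obtain \<Gamma> A where [simp]: "X = ctx_class \<Gamma>" "K = ty_class \<Gamma> A"
    and h: "eq_ctx \<Gamma> \<Gamma>" "eq_ty \<Gamma> A A"
    by (auto elim!: syn_CtxE syn_TyE)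
  obtain K' where "ity A = (ictx \<Gamma>, K')" using ityE[OF h(2)] .
  then show ?case using h by (simp add: syn_Ext syn_P interp cong_P)
next
  case (14 X K)
  then obtain \<Gamma> A where [simp]: "X = ctx_class \<Gamma>" "K = ty_class \<Gamma> A"
    and h: "eq_ctx \<Gamma> \<Gamma>" "eq_ty \<Gamma> A A"
    by (auto elim!: syn_CtxE syn_TyE)
  obtain K' where "ity A = (ictx \<Gamma>, K')" using ityE[OF h(2)] .
  then show ?case using h by (simp add: syn_Ext syn_P syn_Q syn_TySub interp cong_P cong_Q)
qed

lemma interp_base: "FTy interp (One syn_cwf) syn_base = oC"
  using interp_Ty[OF cong_Base] by (simp add: syn_base_def syn_One_def syn_One_class)

end

section \<open>Freeness: existence and uniqueness combined\<close>

theorem theorem3p8: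
  "cwf syn_cwf \<and> syn_base \<in> Ty syn_cwf (One syn_cwf) \<and>
   (\<forall>(C :: ('c, 's, 't, 'm) cwf_data) oC.
      cwf C \<longrightarrow> oC \<in> Ty C (One C) \<longrightarrow>
      (\<exists>!F. strict_cwf_morphism syn_cwf C F \<and> FTy F (One syn_cwf) syn_base = oC))"
proof (intro conjI allI impI)
  show "cwf syn_cwf" by (rule cwf_syn)
  show "syn_base \<in> Ty syn_cwf (One syn_cwf)"
    using syn_mem(3)[OF cong_Base] by (simp add: syn_base_def syn_One_def syn_One_class)
next
  fix C :: "('c, 's, 't, 'm) cwf_data" and oC
  assume "cwf C" "oC \<in> Ty C (One C)"
  then interpret cwf_base C oC
    by (intro cwf_base.intro cwf_base_axioms.intro)
  show "\<exists>!F. strict_cwf_morphism syn_cwf C F \<and> FTy F (One syn_cwf) syn_base = oC"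
  proof (rule ex1I[of _ interp])
    show "strict_cwf_morphism syn_cwf C interp \<and> FTy interp (One syn_cwf) syn_base = oC"
      using interp_morphism interp_base by blast
  next
    fix F assume "strict_cwf_morphism syn_cwf C F \<and> FTy F (One syn_cwf) syn_base = oC"
    \<comment> \<open>\<open>F\<close> and \<open>interp\<close> both send the base class to
      \<open>oC\<close>, which is what the pair locale assumes.\<close>
    then have "syn_morphism_pair C F interp"
      using interp_morphism interp_base
      by (intro syn_morphism_pair.intro syn_morphism.intro syn_morphism_pair_axioms.intro) auto
    then show "F = interp" by (rule syn_morphism_pair.morphisms_eq)
  qed
qed

end
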